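(* Let $\{X_t: t\ge 0\}$ be a purely non-Gaussian $d$-dimensional Lévy process with $X_0=0$ and Lévy measure $\Pi$. Let $h\in\mathcal{H}_1$ and let $b(t)=\sqrt{t\log\log(1/t)}/h(1/t)$ for all sufficiently small $t>0$ (say for $0<t\le t_0$, where $t_0\in(0,e^{-1})$ is such that $b$ is well defined and positive on $(0,t_0]$). Assume that $$\int_0^{t_0}\overline{\Pi}(b(t))\,dt<\infty$$ and that for some $\lambda\ge 0$, $$\limsup_{t\downarrow 0} V(b(t))\,h^2(1/t)\le \lambda^2/2.$$ Then with probability one, $$\limsup_{t\downarrow 0} h(1/t)\frac{|X_t|}{\sqrt{t\log\log(1/t)}}\le\lambda.$$
   Context: A $d$-dimensional Lévy process with $X_0=0$ has characteristic triplet $(\gamma,\Sigma,\Pi)$ with $\gamma\in\mathbb{R}^d$, $\Sigma$ a symmetric non-negative definite $d\times d$ matrix and $\Pi$ a Lévy measure on $\mathbb{R}^d$ (i.e. $\Pi(\{0\})=0$ and $\int(1\wedge|y|^2)\Pi(dy)<\infty$); it is called purely non-Gaussian if $\Sigma=0$. Here $|\cdot|$ is the Euclidean norm and $\langle\cdot,\cdot\rangle$ the Euclidean inner product. Notation: $\overline{\Pi}(x)=\Pi\{y:|y|>x\}$ for $x>0$, and $V(t)=\sup_{|z|\le1}\int_{|y|\le t}\langle y,z\rangle^2\,\Pi(dy)$ for $t\ge0$. $\mathcal{H}_1$ denotes the class of continuous, non-decreasing functions $h:[0,\infty)\to[0,\infty)$ that are slowly varying at infinity. *)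

theory Defs
  imports "HOL-Probability.Probability"
begin

definition levy_measure :: "(real ^ 'd) measure \<Rightarrow> bool" where
  "levy_measure Pm \<longleftrightarrow> sets Pm = sets borel \<and> emeasure Pm {0} = 0 \<and>
     integrable Pm (\<lambda>y. min 1 ((norm y)\<^sup>2))"

text \<open>Characteristic exponent of the triplet (gamma, 0, Pi) (Sigma = 0: purely non-Gaussian).\<close>
definition char_exponent :: "real ^ 'd \<Rightarrow> (real ^ 'd) measure \<Rightarrow> real ^ 'd \<Rightarrow> complex" where
  "char_exponent \<gamma> Pm \<theta> =
     \<i> * complex_of_real (\<gamma> \<bullet> \<theta>)
     + (\<integral>y. (cis (\<theta> \<bullet> y) - 1 - \<i> * complex_of_real (\<theta> \<bullet> y) * indicator {y. norm y \<le> 1} y) \<partial>Pm)"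

definition purely_non_gaussian_levy ::
  "'a measure \<Rightarrow> (real \<Rightarrow> 'a \<Rightarrow> real ^ 'd) \<Rightarrow> real ^ 'd \<Rightarrow> (real ^ 'd) measure \<Rightarrow> bool" where
  "purely_non_gaussian_levy M X \<gamma> Pm \<longleftrightarrow>
     prob_space M \<and> levy_measure Pm \<and>
     (\<forall>t\<ge>0. X t \<in> borel_measurable M) \<and>
     (\<forall>\<omega>\<in>space M. X 0 \<omega> = 0) \<and>
     (\<forall>ts::nat \<Rightarrow> real. 0 \<le> ts 0 \<and> (\<forall>i. ts i \<le> ts (Suc i)) \<longrightarrow>
        (\<forall>n. prob_space.indep_vars M (\<lambda>_. borel) (\<lambda>i \<omega>. X (ts (Suc i)) \<omega> - X (ts i) \<omega>) {..<n})) \<and>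
     (\<forall>s\<ge>0. \<forall>t\<ge>0. distr M borel (\<lambda>\<omega>. X (s + t) \<omega> - X s \<omega>) = distr M borel (X t)) \<and>
     (AE \<omega> in M. \<forall>t\<ge>0. continuous (at_right t) (\<lambda>s. X s \<omega>) \<and>
        (t > 0 \<longrightarrow> (\<exists>l. ((\<lambda>s. X s \<omega>) \<longlongrightarrow> l) (at_left t)))) \<and>
     (\<forall>t\<ge>0. \<forall>\<theta>. (\<integral>\<omega>. cis (\<theta> \<bullet> X t \<omega>) \<partial>M) = exp (complex_of_real t * char_exponent \<gamma> Pm \<theta>))"

definition Pibar :: "(real ^ 'd) measure \<Rightarrow> real \<Rightarrow> ennreal" where
  "Pibar Pm x = emeasure Pm {y. norm y > x}"

definition Vfun :: "(real ^ 'd) measure \<Rightarrow> real \<Rightarrow> real" where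
  "Vfun Pm t = (SUP z\<in>cball 0 1. \<integral>y. indicator {y. norm y \<le> t} y * (y \<bullet> z)\<^sup>2 \<partial>Pm)"

definition H1 :: "(real \<Rightarrow> real) \<Rightarrow> bool" where
  "H1 h \<longleftrightarrow> continuous_on {0..} h \<and> mono_on {0..} h \<and> (\<forall>x\<ge>0. h x \<ge> 0) \<and>
     (\<forall>c>0. ((\<lambda>x. h (c * x) / h x) \<longlongrightarrow> 1) at_top)"

end

(* For a unit vector z the law of <X_t, z> is a weak limit of laws of binomial compound sums
   (one-dimensional Levy continuity theorem), for which the Chernoff bound after discarding the
   jumps longer than c is elementary; this replaces the Levy-Ito decomposition.  With the cut at
   a small multiple of b(t), expanding the exponential moment to third order gives a bound of
   Fuk-Nagaev type
     P(<X_s, z> > k b(t)) <= t Pibar(c) + C (exp(-k^2 b(t)^2 / (2 t V(b(t)))) + beta(t))  (s <= t)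
   where beta(t) is a normalised truncated third moment.  Along t = r^n the terms t Pibar(c) and
   beta(t) are summable since b is regularly varying of order 1/2 and Pibar(b) is integrable; the
   Gaussian term is summable for k > lambda, and the compensating drift is o(b(t)).
   Ottaviani's inequality passes to suprema over [0, r^n], the Borel-Cantelli lemma to almost sure
   bounds, and a finite net of the sphere together with r -> 1 gives the norm with the sharp
   constant. *)

theory Submission
  imports Defs "HOL-Real_Asymp.Real_Asymp"
begin

text \<open>The sharp constant forces the third-order expansion. In units of 1 / b(t) the optimal
  exponential parameter \<open>w\<close> is of order log log(1/t), so with the cut at
  \<open>\<delta> * b\<close> the factor exp(\<open>\<delta> * w\<close>) grows like a power of
  log(1/t). On the quadratic term this factor would spoil lambda; it is left on the cubic term only,
  where it meets beta. As beta is merely summable along t = r^n, it need not beat that power for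
  every n; where it fails to, the parameter is stopped earlier, and the bound obtained is of order
  beta, hence still summable. Both truncated moments obey recursions between neighbouring scales
  with contraction factor near sqrt r, in opposite directions: T / b shrinks, so the compensator of
  the medium jumps is propagated forward; T / b^3 grows, so the third moment is propagated backward
  and needs an a priori bound, taken from the variance hypothesis. The increments are shells between
  consecutive cuts, paid for by t Pibar. The tail bound serves twice: above lambda, where it is
  summable, and at an arbitrarily small level for -z, where it merely tends to 0, as Ottaviani's
  inequality requires.\<close>

subsection \<open>Tail bounds for one-dimensional projections\<close>

text \<open>\<open>Q\<close> is \<open>p \<rho>\<close> with its missing mass placed at the point \<open>y0\<close>.\<close>
lemma thinned_measure_exists:
  fixes \<rho> :: "'b measure" and y0 :: 'b
  assumes "finite_measure \<rho>" and y0: "y0 \<in> space \<rho>"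
    and p: "0 \<le> p" "p * measure \<rho> (space \<rho>) \<le> 1"
  obtains Q where "prob_space Q" "sets Q = sets \<rho>"
    "\<And>f :: 'b \<Rightarrow> real. integrable \<rho> f \<Longrightarrow> f y0 = 0 \<Longrightarrow> integrable Q f \<and> integral\<^sup>L Q f = p * integral\<^sup>L \<rho> f"
    "\<And>f :: 'b \<Rightarrow> complex. integrable \<rho> f \<Longrightarrow> f y0 = 0 \<Longrightarrow> integrable Q f \<and> integral\<^sup>L Q f = p * integral\<^sup>L \<rho> f"
proof -
  interpret finite_measure \<rho> by fact
  define r where "r = measure \<rho> (space \<rho>)"
  have r0: "r \<ge> 0" by (simp add: r_def)
  \<comment> \<open>For a null \<open>\<rho>\<close> there is nothing to normalise; the Bernoulli
    variable below then never selects \<open>\<nu>\<close>, and any probability measure would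
    serve.\<close>
  define \<nu> where "\<nu> = (if r = 0 then return \<rho> y0 else density \<rho> (\<lambda>_. ennreal (1 / r)))"
  have ps: "prob_space \<nu>"
  proof (cases "r = 0")
    case True then show ?thesis by (simp add: \<nu>_def prob_space_return y0)
  next
    case False
    then show ?thesis unfolding \<nu>_def
      by (intro prob_spaceI) (use r0 in \<open>simp add: emeasure_density nn_integral_cmult emeasure_eq_measure
         r_def[symmetric] ennreal_mult[symmetric]\<close>)
  qed
  have sets_\<nu>[measurable_cong]: "sets \<nu> = sets \<rho>" by (simp add: \<nu>_def)
  interpret \<nu>: prob_space \<nu> by fact
  \<comment> \<open>With probability \<open>p * r\<close> the point is drawn from the normalised
    \<open>\<rho>\<close>, otherwise it is \<open>y0\<close>. A function vanishing at
    \<open>y0\<close> does not see the second case.\<close>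
  define B where "B = measure_pmf (bernoulli_pmf (p * r))"
  have pr: "0 \<le> p * r" "p * r \<le> 1" using p r0 by (auto simp: r_def)
  interpret B: prob_space B unfolding B_def by (rule prob_space_measure_pmf)
  interpret P: pair_prob_space B \<nu> ..
  define \<xi> where "\<xi> = (\<lambda>(b::bool,y). if b then y else y0)"
  have sB[measurable_cong]: "sets B = sets (count_space UNIV)" by (simp add: B_def)
  have y0': "y0 \<in> space \<nu>" using y0 sets_eq_imp_space_eq[OF sets_\<nu>] by simp
  have m\<xi>[measurable]: "\<xi> \<in> measurable (B \<Otimes>\<^sub>M \<nu>) \<rho>"
    unfolding \<xi>_def using y0 by measurable
  define Q where "Q = distr (B \<Otimes>\<^sub>M \<nu>) \<rho> \<xi>"
  have main: "integrable Q f \<and> integral\<^sup>L Q f = p *\<^sub>R integral\<^sup>L \<rho> f"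
    if f: "integrable \<rho> f" and f0: "f y0 = 0" for f :: "'b \<Rightarrow> real"
  proof -
    have fm[measurable]: "f \<in> borel_measurable \<rho>" using f by simp
    have fm'[measurable]: "f \<in> borel_measurable \<nu>" using f by simp
    have f\<nu>: "integrable \<nu> f \<and> r *\<^sub>R integral\<^sup>L \<nu> f = integral\<^sup>L \<rho> f"
    proof (cases "r = 0")
      case True
      have *: "emeasure \<rho> (space \<rho>) = 0" using True by (simp add: r_def emeasure_eq_measure)
      have "integral\<^sup>L \<rho> f = 0"
        by (rule integral_eq_zero_AE, rule AE_I[where N="space \<rho>"]) (use * in auto)
      moreover have "integrable \<nu> f"
        unfolding \<nu>_def using True fm y0
        by (auto intro!: integrableI_bounded simp: nn_integral_return)
      ultimately show ?thesis using True by simp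
    next
      case False
      then show ?thesis unfolding \<nu>_def using r0 f
        by (simp add: integrable_density integral_density)
    qed
    have eq: "f (\<xi> x) = indicator {True} (fst x) *\<^sub>R f (snd x)" for x
      by (cases x) (auto simp: \<xi>_def f0)
    have i: "integrable (B \<Otimes>\<^sub>M \<nu>) (\<lambda>x. f (\<xi> x))"
    proof (rule P.Fubini_integrable)
      show "(\<lambda>x. f (\<xi> x)) \<in> borel_measurable (B \<Otimes>\<^sub>M \<nu>)" by measurable
      show "integrable B (\<lambda>x. LINT y|\<nu>. norm (f (\<xi> (x, y))))"
        unfolding B_def by (rule integrable_measure_pmf_finite) simp
      show "AE x in B. integrable \<nu> (\<lambda>y. f (\<xi> (x, y)))"
        unfolding eq using f\<nu> by simp
    qed
    have "integral\<^sup>L (B \<Otimes>\<^sub>M \<nu>) (\<lambda>x. f (\<xi> x)) = (LINT b|B. LINT y|\<nu>. f (\<xi> (b,y)))"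
      using P.integral_fst'[OF i] by simp
    also have "\<dots> = (LINT b|B. indicator {True} b *\<^sub>R integral\<^sup>L \<nu> f)"
      unfolding eq by simp
    also have "\<dots> = (p * r) *\<^sub>R integral\<^sup>L \<nu> f"
      unfolding B_def by (subst integral_measure_pmf[of UNIV]) (auto simp: UNIV_bool pr)
    also have "\<dots> = p *\<^sub>R integral\<^sup>L \<rho> f" using f\<nu> by (metis scaleR_scaleR)
    finally have 1: "integral\<^sup>L (B \<Otimes>\<^sub>M \<nu>) (\<lambda>x. f (\<xi> x)) = p *\<^sub>R integral\<^sup>L \<rho> f" .
    show ?thesis unfolding Q_def using i 1 by (simp add: integrable_distr_eq integral_distr)
  qed
  have "integrable Q f \<and> integral\<^sup>L Q f = p * integral\<^sup>L \<rho> f"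
    if f: "integrable \<rho> f" and f0: "f y0 = 0" for f :: "'b \<Rightarrow> complex"
  proof -
    have R: "integrable Q (\<lambda>y. Re (f y)) \<and> (\<integral>y. Re (f y) \<partial>Q) = p * (\<integral>y. Re (f y) \<partial>\<rho>)"
      and I: "integrable Q (\<lambda>y. Im (f y)) \<and> (\<integral>y. Im (f y) \<partial>Q) = p * (\<integral>y. Im (f y) \<partial>\<rho>)"
      using main[of "\<lambda>y. Re (f y)"] main[of "\<lambda>y. Im (f y)"] f f0 by auto
    have "integrable Q (\<lambda>y. of_real (Re (f y)) + \<i> * of_real (Im (f y)))"
      using R I by auto
    then have i: "integrable Q f" by (simp add: complex_eq[symmetric])
    moreover have "integral\<^sup>L Q f = p * integral\<^sup>L \<rho> f"
      using R I i f by (intro complex_eqI) (simp_all flip: integral_Re integral_Im)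
    ultimately show ?thesis by simp
  qed
  moreover have "prob_space Q" unfolding Q_def by (rule P.prob_space_distr) measurable
  moreover have "sets Q = sets \<rho>" by (simp add: Q_def)
  ultimately show ?thesis using main by (intro that[of Q]) auto
qed

text \<open>A union bound removes the event that some coordinate falls into \<open>A\<close>. Off
  this event \<open>f\<close> may be replaced by its version cut to 0 on \<open>A\<close>, and
  Markov's inequality applies to the product of the exponentials.\<close>

lemma iid_sum_tail:
  fixes Q :: "'b measure" and f :: "'b \<Rightarrow> real"
  assumes "prob_space Q" and [measurable]: "f \<in> borel_measurable Q" "A \<in> sets Q"
    and int: "integrable Q (\<lambda>y. exp (u * (if y \<in> A then 0 else f y)))" and u: "u \<ge> 0"
  shows "measure (PiM {..<m} (\<lambda>_. Q)) {\<omega>\<in>space (PiM {..<m} (\<lambda>_. Q)). (\<Sum>i<m. f (\<omega> i)) > x}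
    \<le> m * measure Q A + exp (- (u * x)) * (\<integral>y. exp (u * (if y \<in> A then 0 else f y)) \<partial>Q) ^ m"
proof -
  interpret Q: prob_space Q by fact
  let ?P = "PiM {..<m} (\<lambda>_. Q)"
  interpret P: prob_space ?P by (intro prob_space_PiM assms)
  interpret S: product_sigma_finite "\<lambda>_::nat. Q" by standard
  define g where "g = (\<lambda>y. if y \<in> A then 0 else f y)"
  have [measurable]: "g \<in> borel_measurable Q" unfolding g_def by measurable
  have ip: "integrable ?P (\<lambda>\<omega>. \<Prod>i<m. exp (u * g (\<omega> i)))"
    by (rule S.product_integrable_prod) (use int in \<open>auto simp: g_def\<close>)
  have eq: "integral\<^sup>L ?P (\<lambda>\<omega>. \<Prod>i<m. exp (u * g (\<omega> i))) = (\<integral>y. exp (u * g y) \<partial>Q) ^ m"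
    by (subst S.product_integral_prod) (use int in \<open>auto simp: g_def\<close>)
  let ?E = "\<lambda>i. {\<omega>\<in>space ?P. \<omega> i \<in> A}"
  let ?F = "{\<omega>\<in>space ?P. (\<Prod>i<m. exp (u * g (\<omega> i))) \<ge> exp (u * x)}"
  have E: "measure ?P (?E i) = measure Q A" if "i < m" for i
  proof -
    have "measure Q A = measure (distr ?P Q (\<lambda>\<omega>. \<omega> i)) A"
      using that by (subst distr_PiM_component) (auto intro: Q.prob_space_axioms)
    also have "\<dots> = measure ?P (?E i)"
      using that by (subst measure_distr) (auto intro!: arg_cong2[where f=measure])
    finally show ?thesis by simp
  qed
  have Em: "?E i \<in> sets ?P" if [measurable]: "i \<in> {..<m}" for i
    by measurable
  have "{\<omega>\<in>space ?P. (\<Sum>i<m. f (\<omega> i)) > x} \<subseteq> (\<Union>i<m. ?E i) \<union> ?F"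
  proof (intro subsetI)
    fix \<omega> assume w: "\<omega> \<in> {\<omega>\<in>space ?P. (\<Sum>i<m. f (\<omega> i)) > x}"
    show "\<omega> \<in> (\<Union>i<m. ?E i) \<union> ?F"
    proof (cases "\<exists>i<m. \<omega> i \<in> A")
      case True with w show ?thesis by auto
    next
      case False
      then have "(\<Sum>i<m. f (\<omega> i)) = (\<Sum>i<m. g (\<omega> i))"
        by (intro sum.cong) (auto simp: g_def)
      with w u have "u * x \<le> u * (\<Sum>i<m. g (\<omega> i))" by (auto intro!: mult_left_mono)
      then show ?thesis using w by (simp add: exp_sum[symmetric] sum_distrib_left)
    qed
  qed
  then have "measure ?P {\<omega>\<in>space ?P. (\<Sum>i<m. f (\<omega> i)) > x} \<le> measure ?P ((\<Union>i<m. ?E i) \<union> ?F)"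
    by (rule P.finite_measure_mono) (auto intro!: sets.Un sets.finite_UN Em)
  also have "\<dots> \<le> measure ?P (\<Union>i<m. ?E i) + measure ?P ?F"
    by (rule measure_Un_le) (auto intro!: sets.finite_UN Em)
  also have "measure ?P (\<Union>i<m. ?E i) \<le> (\<Sum>i<m. measure ?P (?E i))"
    by (rule measure_UNION_le) (auto intro!: Em)
  also have "\<dots> = m * measure Q A" using E by simp
  also have "measure ?P ?F \<le> integral\<^sup>L ?P (\<lambda>\<omega>. \<Prod>i<m. exp (u * g (\<omega> i))) / exp (u * x)"
    by (rule integral_Markov_inequality_measure[where A="space ?P"]) (use ip in \<open>auto intro!: AE_I2 prod_nonneg\<close>)
  finally show ?thesis unfolding eq by (simp add: exp_minus field_simps g_def)
qed

lemma iid_sum_char: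
  fixes Q :: "'b measure" and f :: "'b \<Rightarrow> real"
  assumes "prob_space Q" and [measurable]: "f \<in> borel_measurable Q"
  shows "(\<integral>\<omega>. cis (\<theta> * (\<Sum>i<m. f (\<omega> i))) \<partial>PiM {..<m} (\<lambda>_. Q)) = (\<integral>y. cis (\<theta> * f y) \<partial>Q) ^ m"
proof -
  interpret Q: prob_space Q by fact
  interpret S: product_sigma_finite "\<lambda>_::nat. Q" by standard
  have i: "integrable Q (\<lambda>y. cis (\<theta> * f y))"
    by (rule Q.integrable_const_bound[where B=1]) (auto simp: cis_conv_exp)
  have "cis (\<theta> * (\<Sum>i<m. f (\<omega> i))) = (\<Prod>i<m. cis (\<theta> * f (\<omega> i)))" for \<omega>
    by (simp add: cis_conv_exp exp_sum[symmetric] sum_distrib_left)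
  then show ?thesis using S.product_integral_prod[of "{..<m}" "\<lambda>_ y. cis (\<theta> * f y)"] i by simp
qed

text \<open>\<open>\<mu>\<close> is the law of \<open>a\<close> plus the sum of \<open>f\<close>
  over \<open>m\<close> independent draws from \<open>\<rho>\<close> thinned by
  \<open>T / m\<close>. The missing mass sits at \<open>y0\<close>, which contributes 0 to the sum
  and does not count as a discarded jump. Both the compound Poisson limit of the characteristic
  function and the exponential bound come from comparing a power of \<open>1 + w\<close> with the
  exponential: up to an error of order \<open>1 / m\<close> for the former, and by
  \<open>1 + x \<le> exp x\<close> for the latter.\<close>

lemma compound_poisson_approx:
  fixes \<rho> :: "'b measure" and f :: "'b \<Rightarrow> real"
  assumes "finite_measure \<rho>" and f[measurable]: "f \<in> borel_measurable \<rho>"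
    and y0: "y0 \<in> space \<rho>" "f y0 = 0" "y0 \<notin> A" and A[measurable]: "A \<in> sets \<rho>"
    and T: "0 \<le> T" "2 * (T * measure \<rho> (space \<rho>)) \<le> real m" "0 < m"
  obtains \<mu> where "real_distribution \<mu>"
    "\<And>\<theta>. cmod (char \<mu> \<theta> - cis (\<theta> * a) * exp (T * (\<integral>y. (cis (\<theta> * f y) - 1) \<partial>\<rho>)))
        \<le> 12 * (T * measure \<rho> (space \<rho>))\<^sup>2 / m"
    "\<And>u x. 0 \<le> u \<Longrightarrow> integrable \<rho> (\<lambda>y. exp (u * (if y \<in> A then 0 else f y)) - 1) \<Longrightarrow>
       measure \<mu> {x<..} \<le> T * measure \<rho> A
         + exp (u * (a - x) + T * (\<integral>y. (exp (u * (if y \<in> A then 0 else f y)) - 1) \<partial>\<rho>))"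
proof -
  interpret finite_measure \<rho> by fact
  define R where "R = measure \<rho> (space \<rho>)"
  have R0: "R \<ge> 0" by (simp add: R_def)
  have TR0: "T * R \<ge> 0" using T R0 by simp
  have p: "0 \<le> T / m" "T / m * measure \<rho> (space \<rho>) \<le> 1"
    using T TR0 by (auto simp: R_def[symmetric] field_simps)
  obtain Q where Q: "prob_space Q" and sQ[measurable_cong]: "sets Q = sets \<rho>"
    and Qr: "\<And>f :: 'b \<Rightarrow> real. integrable \<rho> f \<Longrightarrow> f y0 = 0 \<Longrightarrow> integrable Q f \<and> integral\<^sup>L Q f = T / m * integral\<^sup>L \<rho> f"
    and Qc: "\<And>f :: 'b \<Rightarrow> complex. integrable \<rho> f \<Longrightarrow> f y0 = 0 \<Longrightarrow> integrable Q f \<and> integral\<^sup>L Q f = (T / m :: real) * integral\<^sup>L \<rho> f"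
    by (rule thinned_measure_exists[OF \<open>finite_measure \<rho>\<close> y0(1) p]) blast
  interpret Q: prob_space Q by fact
  let ?P = "PiM {..<m} (\<lambda>_. Q)"
  interpret P: prob_space ?P by (intro prob_space_PiM Q)
  define Z where "Z = (\<lambda>\<omega>. a + (\<Sum>i<m. f (\<omega> i)))"
  have Zm[measurable]: "Z \<in> borel_measurable ?P" unfolding Z_def by measurable
  define \<mu> where "\<mu> = distr ?P borel Z"
  have rd: "real_distribution \<mu>" unfolding \<mu>_def by (rule P.real_distribution_distr) simp
  have char_bound: "cmod (char \<mu> \<theta> - cis (\<theta> * a) * exp (T * (\<integral>y. (cis (\<theta> * f y) - 1) \<partial>\<rho>)))
        \<le> 12 * (T * R)\<^sup>2 / m" for \<theta>
  proof -
    let ?z = "\<integral>y. (cis (\<theta> * f y) - 1) \<partial>\<rho>"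
    have bnd: "cmod (cis (\<theta> * f y) - 1) \<le> 2" for y
      using norm_triangle_ineq4[of "cis (\<theta> * f y)" 1] by simp
    have i1: "integrable \<rho> (\<lambda>y. cis (\<theta> * f y) - 1)"
      by (rule integrable_const_bound[where B=2]) (use bnd in \<open>auto simp: cis_conv_exp\<close>)
    have iQ: "integrable Q (\<lambda>y. cis (\<theta> * f y) - 1)"
      and eQ: "(\<integral>y. (cis (\<theta> * f y) - 1) \<partial>Q) = (T / m :: real) * ?z"
      using Qc[OF i1] y0 by auto
    define w where "w = (T / m :: real) * ?z"
    have "integrable Q (\<lambda>y. (cis (\<theta> * f y) - 1) + 1)" using iQ by (rule Bochner_Integration.integrable_add) simp
    then have icis: "integrable Q (\<lambda>y. cis (\<theta> * f y))" by simp
    have eq1: "(\<integral>y. cis (\<theta> * f y) \<partial>Q) = 1 + w"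
      using eQ icis unfolding w_def by (simp add: Q.prob_space algebra_simps)
    have n1: "cmod (1 + w) \<le> 1"
    proof -
      have "cmod (\<integral>y. cis (\<theta> * f y) \<partial>Q) \<le> (\<integral>y. cmod (cis (\<theta> * f y)) \<partial>Q)" by (rule integral_norm_bound)
      also have "\<dots> = 1" by (simp add: Q.prob_space)
      finally show ?thesis unfolding eq1 .
    qed
    have "cmod ?z \<le> (\<integral>y. cmod (cis (\<theta> * f y) - 1) \<partial>\<rho>)" by (rule integral_norm_bound)
    also have "\<dots> \<le> (\<integral>y. 2 \<partial>\<rho>)" using i1 bnd by (intro integral_mono) auto
    finally have z: "cmod ?z \<le> 2 * R" by (simp add: R_def)
    have nw: "cmod w \<le> 2 * (T * R) / m"
    proof -
      have "cmod w = T / m * cmod ?z" using T unfolding w_def by (simp add: norm_mult norm_divide)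
      also have "\<dots> \<le> T / m * (2 * R)" using z p by (intro mult_left_mono) auto
      finally show ?thesis by (simp add: mult.left_commute)
    qed
    have nw1: "cmod w \<le> 1"
    proof -
      have "2 * (T * R) / m \<le> 1" using T by (simp add: R_def)
      with nw show ?thesis by linarith
    qed
    have "Re ?z = (\<integral>y. Re (cis (\<theta> * f y) - 1) \<partial>\<rho>)"
      by (rule integral_Re[OF i1, symmetric])
    also have "\<dots> = - (\<integral>y. 1 - cos (\<theta> * f y) \<partial>\<rho>)" by (simp flip: integral_minus)
    also have "\<dots> \<le> 0" by (simp add: Bochner_Integration.integral_nonneg)
    finally have "Re ?z \<le> 0" .
    moreover have "Re w = T / m * Re ?z" by (simp add: w_def)
    ultimately have "Re w \<le> 0" using mult_nonneg_nonpos[OF p(1)] by simp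
    then have n2: "cmod (exp w) \<le> 1" by simp
    have "exp \<bar>Re w\<bar> \<le> exp 1" using nw1 abs_Re_le_cmod[of w] by simp
    then have e3: "exp \<bar>Re w\<bar> \<le> 3" using exp_le by linarith
    \<comment> \<open>Both \<open>1 + w\<close>, an average of points of the unit circle, and
      \<open>exp w\<close>, as \<open>Re w \<le> 0\<close>, lie in the closed unit disc, so taking
      powers costs only a factor \<open>m\<close>. The second-order Taylor remainder then gives the
      constant 12 as 3 times the square of 2.\<close>
    have "cmod ((1 + w) ^ m - exp w ^ m) \<le> m * cmod ((1 + w) - exp w)"
      by (rule norm_power_diff[OF n1 n2])
    also have "cmod ((1 + w) - exp w) = cmod (exp w - (\<Sum>k\<le>1. w ^ k / fact k))"
      by (simp add: norm_minus_commute)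
    also have "\<dots> \<le> exp \<bar>Re w\<bar> * (cmod w) ^ Suc 1 / fact 1" by (rule Taylor_exp)
    also have "\<dots> \<le> 3 * (2 * (T * R) / m)\<^sup>2"
    proof -
      have "exp \<bar>Re w\<bar> * (cmod w)\<^sup>2 \<le> 3 * (2 * (T * R) / m)\<^sup>2"
        using e3 nw by (intro mult_mono power_mono) auto
      then show ?thesis by (simp add: numeral_2_eq_2)
    qed
    also have "m * (3 * (2 * (T * R) / m)\<^sup>2) = 12 * (T * R)\<^sup>2 / m"
      using T by (simp add: power2_eq_square field_simps)
    finally have main: "cmod ((1 + w) ^ m - exp w ^ m) \<le> 12 * (T * R)\<^sup>2 / m" by (simp add: mult_left_mono)
    have ew: "exp w ^ m = exp (T * ?z)"
      using T by (simp add: w_def exp_of_nat_mult[symmetric])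
    have "char \<mu> \<theta> = (\<integral>\<omega>. cis (\<theta> * a) * cis (\<theta> * (\<Sum>i<m. f (\<omega> i))) \<partial>?P)"
      unfolding char_def \<mu>_def by (subst integral_distr) (auto simp: Z_def cis_conv_exp exp_add[symmetric] algebra_simps)
    also have "\<dots> = cis (\<theta> * a) * (1 + w) ^ m"
      using iid_sum_char[OF Q, of f m \<theta>] eq1 by simp
    finally have "cmod (char \<mu> \<theta> - cis (\<theta> * a) * exp (T * ?z)) = cmod (cis (\<theta> * a) * ((1 + w) ^ m - exp w ^ m))"
      unfolding ew by (simp add: algebra_simps)
    also have "\<dots> = cmod ((1 + w) ^ m - exp w ^ m)" by (simp add: norm_mult)
    finally show ?thesis using main by simp
  qed
  have tail: "measure \<mu> {x<..} \<le> T * measure \<rho> A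
         + exp (u * (a - x) + T * (\<integral>y. (exp (u * (if y \<in> A then 0 else f y)) - 1) \<partial>\<rho>))"
    if u: "0 \<le> u" and int: "integrable \<rho> (\<lambda>y. exp (u * (if y \<in> A then 0 else f y)) - 1)" for u x
  proof -
    let ?g = "\<lambda>y. exp (u * (if y \<in> A then 0 else f y))"
    let ?I = "\<integral>y. (?g y - 1) \<partial>\<rho>"
    have iQ: "integrable Q (\<lambda>y. ?g y - 1)" and eQ: "(\<integral>y. (?g y - 1) \<partial>Q) = T / m * ?I"
      using Qr[OF int] y0 by auto
    have "integrable Q (\<lambda>y. (?g y - 1) + 1)" using iQ by (rule Bochner_Integration.integrable_add) simp
    then have ig: "integrable Q ?g" by simp
    have Eg: "integral\<^sup>L Q ?g = 1 + T / m * ?I" using eQ ig by (simp add: Q.prob_space)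
    have "integrable \<rho> (indicator A :: _ \<Rightarrow> real)"
      by (rule integrable_real_indicator) (auto simp: emeasure_eq_measure)
    then have QA: "measure Q A = T / m * measure \<rho> A"
      using Qr[of "indicator A"] y0 sets.sets_into_space[OF A] sets_eq_imp_space_eq[OF sQ]
      by (simp add: Int_absorb2)
    have "measure \<mu> {x<..} = measure ?P {\<omega>\<in>space ?P. (\<Sum>i<m. f (\<omega> i)) > x - a}"
      unfolding \<mu>_def by (subst measure_distr) (auto simp: Z_def intro!: arg_cong2[where f=measure])
    also have "\<dots> \<le> m * measure Q A + exp (- (u * (x - a))) * integral\<^sup>L Q ?g ^ m"
      by (rule iid_sum_tail[OF Q _ _ ig u]) auto
    also have "m * measure Q A = T * measure \<rho> A" using QA T by simp
    also have "integral\<^sup>L Q ?g ^ m \<le> exp (T / m * ?I) ^ m"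
    proof (rule power_mono)
      show "integral\<^sup>L Q ?g \<le> exp (T / m * ?I)" unfolding Eg by (rule exp_ge_add_one_self)
      show "0 \<le> integral\<^sup>L Q ?g" by (rule Bochner_Integration.integral_nonneg) simp
    qed
    also have "exp (T / m * ?I) ^ m = exp (T * ?I)"
      using T by (simp add: exp_of_nat_mult[symmetric])
    finally show ?thesis by (simp add: exp_add[symmetric] algebra_simps)
  qed
  show ?thesis by (rule that[OF rd char_bound[unfolded R_def] tail])
qed

text \<open>Weak convergence controls tails only at points without atoms. Atoms are countable, so
  such points lie arbitrarily close below \<open>x\<close>; the tail at \<open>x\<close> is smaller
  than the tail there, and continuity of \<open>B\<close> closes the gap.\<close>

lemma weak_conv_tail_le:
  assumes "\<And>n. real_distribution (\<mu> n)" and "real_distribution M" and wc: "weak_conv_m \<mu> M"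
    and bound: "\<And>x. eventually (\<lambda>n. measure (\<mu> n) {x<..} \<le> B x) sequentially"
    and cont: "isCont B x"
  shows "measure M {x<..} \<le> B x"
proof (rule ccontr)
  interpret \<mu>: real_distribution "\<mu> n" for n by fact
  interpret M: real_distribution M by fact
  assume "\<not> ?thesis"
  then have "B x < measure M {x<..}" by simp
  then have "\<forall>\<^sub>F y in at x. B y < measure M {x<..}"
    using cont by (auto simp: isCont_def dest: order_tendstoD(2))
  then obtain d where d: "d > 0" "\<And>y. y \<noteq> x \<Longrightarrow> dist y x < d \<Longrightarrow> B y < measure M {x<..}"
    by (auto simp: eventually_at)
  have "\<not> {x - d<..<x} \<subseteq> {x. measure M {x} > 0}"
    using M.countable_atoms uncountable_open_interval[of "x - d" x] d(1) countable_subset by auto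
  then obtain y where y: "x - d < y" "y < x" "measure M {y} = 0"
    by (auto simp: zero_less_measure_iff)
  have tail: "measure N {y<..} = 1 - cdf N y" if "real_distribution N" for N
  proof -
    interpret N: real_distribution N by fact
    have "{y<..} = space N - {..y}" by auto
    then show ?thesis using N.prob_compl[of "{..y}"] by (simp add: cdf_def)
  qed
  have "(\<lambda>n. 1 - cdf (\<mu> n) y) \<longlonglongrightarrow> 1 - cdf M y"
    using wc y(3) unfolding weak_conv_m_def weak_conv_def
    by (intro tendsto_intros) (auto simp: M.isCont_cdf)
  then have "(\<lambda>n. measure (\<mu> n) {y<..}) \<longlonglongrightarrow> measure M {y<..}"
    using tail[OF \<mu>.real_distribution_axioms] tail[OF M.real_distribution_axioms] by simp
  then have "measure M {y<..} \<le> B y"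
    by (rule tendsto_upperbound[OF _ bound]) simp
  moreover have "measure M {x<..} \<le> measure M {y<..}"
    using y by (intro M.finite_measure_mono) auto
  moreover have "B y < measure M {x<..}" using d(2)[of y] y by (auto simp: dist_real_def)
  ultimately show False by simp
qed

section \<open>Integrability with respect to a Levy measure\<close>

lemma levy_measure_integrable:
  fixes f :: "real ^ 'd \<Rightarrow> 'b::{banach,second_countable_topology}"
  assumes "levy_measure Pm" and f: "f \<in> borel_measurable borel"
    and bnd: "\<And>y. norm (f y) \<le> C * min 1 ((norm y)\<^sup>2)"
  shows "integrable Pm f"
proof -
  have s[measurable_cong]: "sets Pm = sets borel" and i: "integrable Pm (\<lambda>y. min 1 ((norm y)\<^sup>2))"
    using assms by (auto simp: levy_measure_def)
  show ?thesis
  proof (rule Bochner_Integration.integrable_bound)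
    show "integrable Pm (\<lambda>y. C * min 1 ((norm y)\<^sup>2))" using i by simp
    show "f \<in> borel_measurable Pm" using f by measurable
    show "AE y in Pm. norm (f y) \<le> norm (C * min 1 ((norm y)\<^sup>2))"
      using bnd by (intro AE_I2) (smt (verit) real_norm_def)
  qed
qed

lemma levy_measure_integrable_outside_ball:
  fixes f :: "real ^ 'd \<Rightarrow> 'b::{banach,second_countable_topology}"
  assumes "levy_measure Pm" and f: "f \<in> borel_measurable borel" and c: "0 < c"
    and zero: "\<And>y. norm y \<le> c \<Longrightarrow> f y = 0" and bnd: "\<And>y. norm (f y) \<le> K"
  shows "integrable Pm f"
proof (rule levy_measure_integrable[OF assms(1) f, where C="K * max 1 (1 / c\<^sup>2)"])
  fix y :: "real ^ 'd"
  have K: "K \<ge> 0" using bnd[of y] norm_ge_zero order_trans by blast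
  show "norm (f y) \<le> K * max 1 (1 / c\<^sup>2) * min 1 ((norm y)\<^sup>2)"
  proof (cases "norm y \<le> c")
    case True
    then show ?thesis using zero K by simp
  next
    case False
    then have "c\<^sup>2 \<le> (norm y)\<^sup>2" using c by (intro power_mono) auto
    then have "1 \<le> 1 / c\<^sup>2 * (norm y)\<^sup>2" using c by (simp add: field_simps)
    also have "\<dots> \<le> max 1 (1 / c\<^sup>2) * (norm y)\<^sup>2" by (intro mult_right_mono) auto
    finally have "1 \<le> max 1 (1 / c\<^sup>2) * min 1 ((norm y)\<^sup>2)"
      by (cases "1 \<le> (norm y)\<^sup>2") (simp_all only: min_absorb1 min_absorb2 mult_1_right max.cobounded1 linorder_not_le less_imp_le)
    then have "K * 1 \<le> K * (max 1 (1 / c\<^sup>2) * min 1 ((norm y)\<^sup>2))"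
      using K by (intro mult_left_mono) auto
    then show ?thesis using bnd[of y] by (simp add: mult.assoc)
  qed
qed

lemma levy_measure_tail_finite:
  fixes Pm :: "(real ^ 'd) measure"
  assumes "levy_measure Pm" "0 < c"
  shows "emeasure Pm {y. norm y > c} < \<infinity>"
proof -
  have s[measurable_cong]: "sets Pm = sets borel" using assms by (simp add: levy_measure_def)
  have "integrable Pm (indicator {y. norm y > c} :: _ \<Rightarrow> real)"
    by (rule levy_measure_integrable_outside_ball[OF assms(1) _ assms(2), where K=1])
       (auto simp: indicator_def)
  then show ?thesis by (subst (asm) integrable_indicator_iff) (auto simp: sets_eq_imp_space_eq[OF s])
qed

lemma cis_second_order: "cmod (cis x - 1 - \<i> * x) \<le> x\<^sup>2"
proof -
  have "cmod (iexp x - (1 + \<i> * x)) \<le> x\<^sup>2 / 2"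
    using iexp_approx1[of x 1] by (simp add: power2_eq_square)
  also have "\<dots> \<le> x\<^sup>2" by simp
  finally show ?thesis by (simp add: cis_conv_exp algebra_simps)
qed

lemma compensated_cis_bound:
  fixes y :: "real ^ 'd"
  shows "cmod (cis (\<theta> * (y \<bullet> z)) - 1 - \<i> * complex_of_real (\<theta> * (y \<bullet> z)) * indicator {y. norm y \<le> 1} y)
    \<le> (2 + (\<theta> * norm z)\<^sup>2) * min 1 ((norm y)\<^sup>2)"
proof (cases "norm y \<le> 1")
  case True
  have "cmod (cis (\<theta> * (y \<bullet> z)) - 1 - \<i> * complex_of_real (\<theta> * (y \<bullet> z))) \<le> (\<theta> * (y \<bullet> z))\<^sup>2"
    by (rule cis_second_order)
  also have "\<dots> = \<bar>\<theta> * (y \<bullet> z)\<bar>\<^sup>2" by simp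
  also have "\<dots> \<le> (\<bar>\<theta>\<bar> * (norm y * norm z))\<^sup>2"
    unfolding abs_mult by (intro power_mono mult_left_mono Cauchy_Schwarz_ineq2) auto
  also have "\<dots> = (\<theta> * norm z)\<^sup>2 * (norm y)\<^sup>2" by (simp add: power_mult_distrib algebra_simps)
  also have "\<dots> \<le> (2 + (\<theta> * norm z)\<^sup>2) * (norm y)\<^sup>2" by (intro mult_right_mono) auto
  also have "(norm y)\<^sup>2 = min 1 ((norm y)\<^sup>2)" using True by (simp add: power_le_one min_absorb2)
  finally show ?thesis using True by simp
next
  case False
  then have m: "min 1 ((norm y)\<^sup>2) = 1" by (simp add: min_def)
  have "cmod (cis (\<theta> * (y \<bullet> z)) - 1) \<le> 2"
    using norm_triangle_ineq4[of "cis (\<theta> * (y \<bullet> z))" 1] by simp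
  moreover have "0 \<le> (\<theta> * norm z)\<^sup>2" by simp
  ultimately have "cmod (cis (\<theta> * (y \<bullet> z)) - 1) \<le> 2 + (\<theta> * norm z)\<^sup>2" by linarith
  then show ?thesis using False m by simp
qed

lemma exp_second_order: "\<bar>exp x - 1 - x\<bar> \<le> exp \<bar>x\<bar> * x\<^sup>2" for x :: real
  using Taylor_exp_field[of x 1] by (simp add: power2_eq_square algebra_simps abs_mult)

text \<open>Compound sums built from \<open>Pm\<close> restricted to
  \<open>norm y > 1 / (k + 1)\<close> satisfy this bound for all large \<open>k\<close>, because
  \<open>exp x - 1 - x \<ge> 0\<close> makes the omitted small jumps lower the exponent; the bound
  then passes to the weak limit. The last term of the integrand is the compensator of the jumps with
  \<open>c < norm y \<le> 1\<close>: these jumps are discarded, but their compensation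
  stays.\<close>

lemma levy_projection_chernoff:
  fixes Pm :: "(real ^ 'd) measure" and X :: "real \<Rightarrow> 'a \<Rightarrow> real ^ 'd"
  assumes levy: "purely_non_gaussian_levy M X \<gamma> Pm"
    and t: "0 \<le> t" and c: "0 < c" "c \<le> 1" and u: "0 \<le> u"
  shows "measure M {\<omega>\<in>space M. X t \<omega> \<bullet> z > x}
    \<le> t * measure Pm {y. norm y > c}
      + exp (u * (t * (\<gamma> \<bullet> z) - x)
             + t * (\<integral>y. indicator {y. norm y \<le> c} y * (exp (u * (y \<bullet> z)) - 1 - u * (y \<bullet> z))
                       - u * (indicator {y. c < norm y \<and> norm y \<le> 1} y * (y \<bullet> z)) \<partial>Pm))"
    (is "_ \<le> _ + exp (_ + t * integral\<^sup>L Pm ?F)")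
proof -
  have lm: "levy_measure Pm" and "prob_space M" and Xm[measurable]: "X t \<in> borel_measurable M"
    using levy t by (auto simp: purely_non_gaussian_levy_def)
  have cf: "(\<integral>\<omega>. cis (\<theta> \<bullet> X t \<omega>) \<partial>M) = exp (complex_of_real t * char_exponent \<gamma> Pm \<theta>)" for \<theta>
    using levy t unfolding purely_non_gaussian_levy_def by blast
  interpret prob_space M by fact
  have s[measurable_cong]: "sets Pm = sets borel" using lm by (simp add: levy_measure_def)
  have sp[simp]: "space Pm = UNIV" using sets_eq_imp_space_eq[OF s] by simp
  define S where "S k = {y::real^'d. norm y > 1 / real (Suc k)}" for k
  have Sm[measurable]: "S k \<in> sets borel" for k unfolding S_def by measurable
  have Sm'[measurable]: "S k \<in> sets Pm" for k by measurable
  have Sfin: "emeasure Pm (S k) < \<infinity>" for k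
    unfolding S_def by (rule levy_measure_tail_finite[OF lm]) simp
  \<comment> \<open>Restricting by a density keeps the whole space as carrier, so the origin, which
    has been cut away from the mass, can still play the part of \<open>y0\<close>.\<close>
  define \<rho> where "\<rho> k = density Pm (indicator (S k))" for k
  have \<rho>s[measurable_cong]: "sets (\<rho> k) = sets borel" for k by (simp add: \<rho>_def s)
  have \<rho>sp[simp]: "space (\<rho> k) = UNIV" for k by (simp add: \<rho>_def)
  have e\<rho>: "emeasure (\<rho> k) B = emeasure Pm (S k \<inter> B)" if [measurable]: "B \<in> sets borel" for k B
    unfolding \<rho>_def by (subst emeasure_restricted) auto
  have fin\<rho>: "finite_measure (\<rho> k)" for k
    by (rule finite_measureI) (use Sfin[of k] in \<open>simp add: e\<rho>\<close>)
  have m\<rho>: "measure (\<rho> k) B = measure Pm (S k \<inter> B)" if [measurable]: "B \<in> sets borel" for k B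
    by (simp add: measure_def e\<rho>)
  define R where "R k = measure (\<rho> k) (space (\<rho> k))" for k
  have i\<rho>: "integral\<^sup>L (\<rho> k) f = (\<integral>y. indicator (S k) y *\<^sub>R f y \<partial>Pm)"
    if [measurable]: "f \<in> borel_measurable borel" for k and f :: "real ^ 'd \<Rightarrow> real"
    unfolding \<rho>_def using integral_density[of f Pm "indicator (S k)"]
    by (simp add: ennreal_indicator)
  have i\<rho>c: "integral\<^sup>L (\<rho> k) f = (\<integral>y. indicator (S k) y *\<^sub>R f y \<partial>Pm)"
    if [measurable]: "f \<in> borel_measurable borel" for k and f :: "real ^ 'd \<Rightarrow> complex"
    unfolding \<rho>_def using integral_density[of f Pm "indicator (S k)"]
    by (simp add: ennreal_indicator)
  have int\<rho>: "integrable (\<rho> k) f"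
    if [measurable]: "f \<in> borel_measurable borel" and "\<And>y. \<bar>f y\<bar> \<le> K" for k K and f :: "real ^ 'd \<Rightarrow> real"
    using that by (intro finite_measure.integrable_const_bound[OF fin\<rho>, where B=K]) auto
  define f where "f y = y \<bullet> z" for y :: "real ^ 'd"
  have fm[measurable]: "f \<in> borel_measurable borel" unfolding f_def by measurable
  define A where "A = {y::real^'d. norm y > c}"
  have Am[measurable]: "A \<in> sets borel" unfolding A_def by measurable
  \<comment> \<open>The number of summands makes the error of \<open>compound_poisson_approx\<close> at most \<open>1 / (k + 1)\<close>.\<close>
  define m where "m k = nat \<lceil>real (Suc k) * (12 * (t * R k)\<^sup>2) + 2 * (t * R k) + 1\<rceil>" for k
  have R0: "t * R k \<ge> 0" for k using t by (simp add: R_def)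
  have m_ge: "real (m k) \<ge> real (Suc k) * (12 * (t * R k)\<^sup>2) + 2 * (t * R k) + 1" for k
    unfolding m_def using R0 by (smt (verit) of_nat_ceiling)
  have sq0: "real (Suc k) * (12 * (t * R k)\<^sup>2) \<ge> 0" for k by simp
  have m1: "real (m k) \<ge> 1" "2 * (t * R k) \<le> real (m k)" "real (Suc k) * (12 * (t * R k)\<^sup>2) \<le> real (m k)" for k
    using m_ge[of k] sq0[of k] R0[of k] by linarith+
  have m0: "0 < m k" for k using m1(1)[of k] by (metis gr0I not_one_le_zero of_nat_0)
  define J where "J k = S k \<inter> {y. norm y \<le> 1}" for k
  have Jm[measurable]: "J k \<in> sets borel" for k unfolding J_def by measurable
  have fb: "\<bar>f y\<bar> \<le> norm y * norm z" for y unfolding f_def by (rule Cauchy_Schwarz_ineq2)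
  have fb1: "\<bar>f y\<bar> \<le> norm z" if "norm y \<le> 1" for y
    using fb[of y] that mult_right_mono[of "norm y" 1 "norm z"] by simp
  have Jint: "integrable Pm (\<lambda>y. indicator (J k) y * f y)" for k
    by (rule levy_measure_integrable_outside_ball[OF lm, where c="1 / Suc k" and K="norm z"])
       (auto simp: J_def S_def indicator_def fb1)
  \<comment> \<open>The compensator of the retained jumps of norm at most 1 is moved into the
    deterministic shift. The limiting exponent is then \<open>t\<close> times the characteristic
    exponent with its integral restricted to \<open>S k\<close>.\<close>
  define a where "a k = t * (\<gamma> \<bullet> z) - t * (\<integral>y. indicator (J k) y * f y \<partial>Pm)" for k
  define P where "P k \<mu> \<longleftrightarrow> real_distribution \<mu> \<and>
    (\<forall>\<theta>. cmod (char \<mu> \<theta> - cis (\<theta> * a k) * exp (t * (\<integral>y. (cis (\<theta> * f y) - 1) \<partial>\<rho> k)))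
        \<le> 12 * (t * R k)\<^sup>2 / m k) \<and>
    (\<forall>x. integrable (\<rho> k) (\<lambda>y. exp (u * (if y \<in> A then 0 else f y)) - 1) \<longrightarrow>
       measure \<mu> {x<..} \<le> t * measure (\<rho> k) A
         + exp (u * (a k - x) + t * (\<integral>y. (exp (u * (if y \<in> A then 0 else f y)) - 1) \<partial>\<rho> k)))" for k \<mu>
  have "\<exists>\<mu>. P k \<mu>" for k
    unfolding P_def R_def
    apply (rule compound_poisson_approx[OF fin\<rho>[of k], of f 0 A t "m k" "a k"])
    subgoal by measurable
    subgoal by simp
    subgoal by (simp add: f_def)
    subgoal using c by (simp add: A_def)
    subgoal by measurable
    subgoal by (rule t)
    subgoal using m1(2) by (simp add: R_def)
    subgoal by (rule m0)
    subgoal using u by blast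
    done
  then obtain \<mu> where "\<And>k. P k (\<mu> k)" by metis
  then have rd: "\<And>k. real_distribution (\<mu> k)" and
    chb: "\<And>k \<theta>. cmod (char (\<mu> k) \<theta> - cis (\<theta> * a k) * exp (t * (\<integral>y. (cis (\<theta> * f y) - 1) \<partial>\<rho> k)))
        \<le> 12 * (t * R k)\<^sup>2 / m k" and
    tail: "\<And>k x. integrable (\<rho> k) (\<lambda>y. exp (u * (if y \<in> A then 0 else f y)) - 1) \<Longrightarrow>
       measure (\<mu> k) {x<..} \<le> t * measure (\<rho> k) A
         + exp (u * (a k - x) + t * (\<integral>y. (exp (u * (if y \<in> A then 0 else f y)) - 1) \<partial>\<rho> k))"
    unfolding P_def by blast+
  define D where "D = distr M borel (\<lambda>\<omega>. X t \<omega> \<bullet> z)"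
  have rdD: "real_distribution D" unfolding D_def by (rule real_distribution_distr) simp
  have "(\<lambda>k. char (\<mu> k) \<theta>) \<longlonglongrightarrow> char D \<theta>" for \<theta>
  proof -
    let ?G = "\<lambda>y. cis (\<theta> * f y) - 1 - \<i> * complex_of_real (\<theta> * f y) * indicator {y. norm y \<le> 1} y"
    have Gm[measurable]: "?G \<in> borel_measurable borel"
      unfolding cis_conv_exp by measurable
    have Gb: "cmod (?G y) \<le> (2 + (\<theta> * norm z)\<^sup>2) * min 1 ((norm y)\<^sup>2)" for y
      unfolding f_def by (rule compensated_cis_bound)
    have Gi: "integrable Pm ?G" by (rule levy_measure_integrable[OF lm Gm Gb])
    have lim: "(\<lambda>k. \<integral>y. indicator (S k) y *\<^sub>R ?G y \<partial>Pm) \<longlonglongrightarrow> integral\<^sup>L Pm ?G"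
    proof (rule integral_dominated_convergence[where w="\<lambda>y. cmod (?G y)"])
      show "integrable Pm (\<lambda>y. cmod (?G y))" using Gi by simp
      show "AE y in Pm. (\<lambda>k. indicator (S k) y *\<^sub>R ?G y) \<longlonglongrightarrow> ?G y"
      proof (intro AE_I2)
        fix y :: "real ^ 'd"
        show "(\<lambda>k. indicator (S k) y *\<^sub>R ?G y) \<longlonglongrightarrow> ?G y"
        proof (cases "y = 0")
          case True then show ?thesis by (simp add: f_def)
        next
          case False
          then have "0 < norm y" by simp
          then have "\<forall>\<^sub>F k in sequentially. 1 / real (Suc k) < norm y"
            using LIMSEQ_inverse_real_of_nat by (simp add: order_tendstoD(2) inverse_eq_divide)
          then have "\<forall>\<^sub>F k in sequentially. indicator (S k) y *\<^sub>R ?G y = ?G y"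
            by eventually_elim (simp add: S_def)
          then show ?thesis by (rule tendsto_eventually)
        qed
      qed
      show "AE y in Pm. cmod (indicator (S k) y *\<^sub>R ?G y) \<le> cmod (?G y)" for k
        by (auto simp: indicator_def)
    qed measurable
    have eq: "cis (\<theta> * a k) * exp (t * (\<integral>y. (cis (\<theta> * f y) - 1) \<partial>\<rho> k))
       = exp (t * (\<i> * (\<theta> * (\<gamma> \<bullet> z)) + (\<integral>y. indicator (S k) y *\<^sub>R ?G y \<partial>Pm)))" for k
    proof -
      have ci: "integrable Pm (\<lambda>y. indicator (S k) y *\<^sub>R (cis (\<theta> * f y) - 1))"
      proof (rule levy_measure_integrable_outside_ball[OF lm, where c="1 / Suc k" and K=2])
        show "(\<lambda>y. indicat_real (S k) y *\<^sub>R (cis (\<theta> * f y) - 1)) \<in> borel_measurable borel"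
          unfolding cis_conv_exp by measurable
        show "norm (indicat_real (S k) y *\<^sub>R (cis (\<theta> * f y) - 1)) \<le> 2" for y
          using norm_triangle_ineq4[of "cis (\<theta> * f y)" 1] by (auto simp: indicator_def)
      qed (auto simp: S_def)
      have "(\<integral>y. indicator (S k) y *\<^sub>R ?G y \<partial>Pm)
        = (\<integral>y. indicator (S k) y *\<^sub>R (cis (\<theta> * f y) - 1) - \<i> * \<theta> * complex_of_real (indicator (J k) y * f y) \<partial>Pm)"
        by (rule Bochner_Integration.integral_cong) (auto simp: J_def indicator_def)
      also have "\<dots> = (\<integral>y. indicator (S k) y *\<^sub>R (cis (\<theta> * f y) - 1) \<partial>Pm)
          - \<i> * \<theta> * complex_of_real (\<integral>y. indicator (J k) y * f y \<partial>Pm)"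
        using ci Jint[of k] by (subst Bochner_Integration.integral_diff) (auto simp del: of_real_mult)
      also have "(\<integral>y. indicator (S k) y *\<^sub>R (cis (\<theta> * f y) - 1) \<partial>Pm) = (\<integral>y. (cis (\<theta> * f y) - 1) \<partial>\<rho> k)"
        by (subst i\<rho>c) (auto simp: cis_conv_exp)
      finally have e: "(\<integral>y. indicator (S k) y *\<^sub>R ?G y \<partial>Pm) = (\<integral>y. (cis (\<theta> * f y) - 1) \<partial>\<rho> k)
          - \<i> * \<theta> * complex_of_real (\<integral>y. indicator (J k) y * f y \<partial>Pm)" .
      have gen: "cis (\<theta> * (t * g - t * j)) * exp (t * W) = exp (t * (\<i> * (\<theta> * g) + (W - \<i> * \<theta> * complex_of_real j)))"
        for g j :: real and W :: complex
        by (simp add: cis_conv_exp exp_add[symmetric] algebra_simps)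
      show ?thesis unfolding e a_def by (rule gen)
    qed
    have "char D \<theta> = (\<integral>\<omega>. cis ((\<theta> *\<^sub>R z) \<bullet> X t \<omega>) \<partial>M)"
      unfolding char_def D_def by (subst integral_distr) (auto simp: cis_conv_exp inner_commute)
    also have "\<dots> = exp (t * (\<i> * (\<theta> * (\<gamma> \<bullet> z)) + integral\<^sup>L Pm ?G))"
      unfolding cf char_exponent_def f_def by (simp add: inner_commute)
    finally have "(\<lambda>k. cis (\<theta> * a k) * exp (t * (\<integral>y. (cis (\<theta> * f y) - 1) \<partial>\<rho> k))) \<longlonglongrightarrow> char D \<theta>"
      unfolding eq by (simp only:) (intro tendsto_intros lim)
    moreover have "(\<lambda>k. char (\<mu> k) \<theta> - cis (\<theta> * a k) * exp (t * (\<integral>y. (cis (\<theta> * f y) - 1) \<partial>\<rho> k))) \<longlonglongrightarrow> 0"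
    proof (rule Lim_null_comparison[OF always_eventually LIMSEQ_inverse_real_of_nat], intro allI)
      fix k
      have "12 * (t * R k)\<^sup>2 / m k \<le> inverse (Suc k)"
        using m1(1,3)[of k] by (simp add: field_simps)
      then show "norm (char (\<mu> k) \<theta> - cis (\<theta> * a k) * exp (t * (\<integral>y. (cis (\<theta> * f y) - 1) \<partial>\<rho> k))) \<le> inverse (Suc k)"
        using chb[of k \<theta>] by linarith
    qed
    ultimately show ?thesis using tendsto_add by fastforce
  qed
  then have wc: "weak_conv_m \<mu> D" by (rule levy_continuity[OF rd rdD])
  have Fi: "integrable Pm ?F"
  proof (rule Bochner_Integration.integrable_diff)
    show "integrable Pm (\<lambda>y. indicator {y. norm y \<le> c} y * (exp (u * (y \<bullet> z)) - 1 - u * (y \<bullet> z)))"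
    proof (rule levy_measure_integrable[OF lm, where C="exp (u * norm z) * (u * norm z)\<^sup>2"])
      fix y :: "real ^ 'd"
      show "norm (indicat_real {y. norm y \<le> c} y * (exp (u * (y \<bullet> z)) - 1 - u * (y \<bullet> z)))
         \<le> exp (u * norm z) * (u * norm z)\<^sup>2 * min 1 ((norm y)\<^sup>2)"
      proof (cases "norm y \<le> c")
        case True
        then have y1: "norm y \<le> 1" using c by simp
        have "\<bar>exp (u * f y) - 1 - u * f y\<bar> \<le> exp \<bar>u * f y\<bar> * (u * f y)\<^sup>2" by (rule exp_second_order)
        also have "\<dots> = exp \<bar>u * f y\<bar> * \<bar>u * f y\<bar>\<^sup>2" by simp
        also have "\<dots> \<le> exp (u * norm z) * (u * (norm y * norm z))\<^sup>2"
          unfolding abs_mult abs_of_nonneg[OF u]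
          using u fb[of y] fb1[OF y1] by (intro mult_mono power_mono) (auto intro: mult_left_mono)
        also have "\<dots> = exp (u * norm z) * (u * norm z)\<^sup>2 * (norm y)\<^sup>2"
          by (simp add: power_mult_distrib)
        also have "(norm y)\<^sup>2 = min 1 ((norm y)\<^sup>2)" using y1 by (simp add: power_le_one min_absorb2)
        finally show ?thesis using True by (simp add: f_def)
      qed simp
    qed measurable
    show "integrable Pm (\<lambda>y. u * (indicator {y. c < norm y \<and> norm y \<le> 1} y * (y \<bullet> z)))"
      by (rule levy_measure_integrable_outside_ball[OF lm _ c(1), where K="u * norm z"])
         (use u fb1 in \<open>auto simp: indicator_def f_def[symmetric] abs_mult intro: mult_left_mono\<close>)
  qed
  have ev: "\<forall>\<^sub>F k in sequentially. measure (\<mu> k) {x<..} \<le> t * measure Pm A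
      + exp (u * (t * (\<gamma> \<bullet> z) - x) + t * integral\<^sup>L Pm ?F)" for x
  proof -
    have "\<forall>\<^sub>F k in sequentially. 1 / real (Suc k) < c"
      using c LIMSEQ_inverse_real_of_nat by (simp add: order_tendstoD(2) inverse_eq_divide)
    then show ?thesis
    proof eventually_elim
      case (elim k)
      let ?g = "\<lambda>y. exp (u * (if y \<in> A then 0 else f y)) - 1"
      have gb: "\<bar>?g y\<bar> \<le> exp (u * norm z) + 1" for y
      proof (cases "y \<in> A")
        case False
        then have "norm y \<le> 1" using c by (auto simp: A_def)
        then have "exp (u * f y) \<le> exp (u * norm z)" using fb1[of y] u by (auto intro: mult_left_mono)
        moreover have "exp (u * f y) > 0" by simp
        ultimately have "\<bar>exp (u * f y) - 1\<bar> \<le> exp (u * norm z) + 1" by linarith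
        then show ?thesis using False by simp
      qed simp
      have gi: "integrable (\<rho> k) ?g" by (rule int\<rho>[OF _ gb]) measurable
      have giP: "integrable Pm (\<lambda>y. indicator (S k) y * ?g y)"
      proof (rule levy_measure_integrable_outside_ball[OF lm, where c="1 / Suc k" and K="exp (u * norm z) + 1"])
        show "norm (indicator (S k) y * ?g y) \<le> exp (u * norm z) + 1" for y
          using gb[of y] by (auto simp: indicator_def)
      qed (auto simp: S_def)
      have SA: "S k \<inter> A = A" using elim by (auto simp: S_def A_def)
      have "integral\<^sup>L (\<rho> k) ?g = (\<integral>y. indicator (S k) y * ?g y \<partial>Pm)"
        by (subst i\<rho>) auto
      then have e1: "u * (a k - x) + t * integral\<^sup>L (\<rho> k) ?g
         = u * (t * (\<gamma> \<bullet> z) - x) + t * (\<integral>y. indicator (S k) y * ?g y - u * (indicator (J k) y * f y) \<partial>Pm)"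
        unfolding a_def using giP Jint[of k]
        by (subst Bochner_Integration.integral_diff) (auto simp: algebra_simps)
      \<comment> \<open>The integrands agree for \<open>norm y > 1 / (k + 1)\<close>; on the
        remaining ball the left one is 0 and the right one nonnegative.\<close>
      have e2: "(\<integral>y. indicator (S k) y * ?g y - u * (indicator (J k) y * f y) \<partial>Pm) \<le> integral\<^sup>L Pm ?F"
      proof (rule integral_mono)
        show "integrable Pm (\<lambda>y. indicator (S k) y * ?g y - u * (indicator (J k) y * f y))"
          using giP Jint[of k] by auto
        fix y :: "real ^ 'd"
        have "exp (u * f y) - 1 - u * f y \<ge> 0" using exp_ge_add_one_self[of "u * f y"] by linarith
        then show "indicator (S k) y * ?g y - u * (indicator (J k) y * f y) \<le> ?F y"
          using elim c by (auto simp: J_def S_def A_def f_def[symmetric] indicator_def)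
      qed (rule Fi)
      have "u * (a k - x) + t * integral\<^sup>L (\<rho> k) ?g \<le> u * (t * (\<gamma> \<bullet> z) - x) + t * integral\<^sup>L Pm ?F"
        unfolding e1 using mult_left_mono[OF e2 t] by (rule add_left_mono)
      then have "exp (u * (a k - x) + t * integral\<^sup>L (\<rho> k) ?g)
          \<le> exp (u * (t * (\<gamma> \<bullet> z) - x) + t * integral\<^sup>L Pm ?F)" by (simp only: exp_le_cancel_iff)
      then show ?case using tail[OF gi, of x] unfolding m\<rho>[OF Am] SA by linarith
    qed
  qed
  have "measure D {x<..} \<le> t * measure Pm A + exp (u * (t * (\<gamma> \<bullet> z) - x) + t * integral\<^sup>L Pm ?F)"
    by (rule weak_conv_tail_le[OF rd rdD wc ev]) (intro continuous_intros)
  also have "measure D {x<..} = measure M {\<omega>\<in>space M. X t \<omega> \<bullet> z > x}"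
    unfolding D_def by (subst measure_distr) (auto intro!: arg_cong2[where f=measure])
  finally show ?thesis by (simp add: A_def)
qed

text \<open>The coefficient 1/2 of the square is kept exact, since it decides the constant in the
  limsup; the cubic remainder can be crude.\<close>

lemma exp_third_order: "exp x - 1 - x \<le> x\<^sup>2 / 2 + \<bar>x\<bar> ^ 3 * exp \<bar>x\<bar>" for x :: real
proof -
  have "\<bar>exp x - (1 + x + x\<^sup>2 / 2)\<bar> \<le> exp \<bar>x\<bar> * \<bar>x\<bar> ^ 3 / 2"
    using Taylor_exp_field[of x 2] by (simp add: eval_nat_numeral)
  also have "\<dots> \<le> \<bar>x\<bar> ^ 3 * exp \<bar>x\<bar>" by simp
  finally show ?thesis by linarith
qed

lemma levy_truncated_integrable:
  fixes Pm :: "(real ^ 'd) measure"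
  assumes lm: "levy_measure Pm" and c: "c \<le> 1"
  shows "integrable Pm (\<lambda>y. indicator {y. norm y \<le> c} y * (y \<bullet> z)\<^sup>2)"
    and "integrable Pm (\<lambda>y. indicator {y. norm y \<le> c} y * (norm y * (y \<bullet> z)\<^sup>2))"
proof -
  have *: "(y \<bullet> z)\<^sup>2 \<le> (norm z)\<^sup>2 * min 1 ((norm y)\<^sup>2)" if "norm y \<le> c" for y :: "real ^ 'd"
  proof -
    have "\<bar>y \<bullet> z\<bar>\<^sup>2 \<le> (norm y * norm z)\<^sup>2" by (intro power_mono Cauchy_Schwarz_ineq2) auto
    also have "\<dots> = (norm z)\<^sup>2 * (norm y)\<^sup>2" by (simp add: power_mult_distrib)
    also have "(norm y)\<^sup>2 = min 1 ((norm y)\<^sup>2)" using that c by (simp add: power_le_one min_absorb2)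
    finally show ?thesis by simp
  qed
  show "integrable Pm (\<lambda>y. indicator {y. norm y \<le> c} y * (y \<bullet> z)\<^sup>2)"
    by (rule levy_measure_integrable[OF lm, where C="(norm z)\<^sup>2"])
       (use * in \<open>auto simp: indicator_def\<close>)
  show "integrable Pm (\<lambda>y. indicator {y. norm y \<le> c} y * (norm y * (y \<bullet> z)\<^sup>2))"
  proof (rule levy_measure_integrable[OF lm, where C="(norm z)\<^sup>2"])
    fix y :: "real ^ 'd"
    have "norm y * (y \<bullet> z)\<^sup>2 \<le> 1 * (y \<bullet> z)\<^sup>2" if "norm y \<le> c"
      using that c by (intro mult_right_mono) auto
    then show "norm (indicator {y. norm y \<le> c} y * (norm y * (y \<bullet> z)\<^sup>2)) \<le> (norm z)\<^sup>2 * min 1 ((norm y)\<^sup>2)"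
      using *[of y] by (cases "norm y \<le> c") (auto simp: indicator_def)
  qed measurable
qed

lemma levy_medium_jumps_integrable:
  fixes Pm :: "(real ^ 'd) measure"
  assumes lm: "levy_measure Pm" and c: "0 < c"
  shows "integrable Pm (\<lambda>y. indicator {y. c < norm y \<and> norm y \<le> 1} y * norm y)"
  by (rule levy_measure_integrable_outside_ball[OF lm _ c, where K=1]) (auto simp: indicator_def)

text \<open>The linear part, from the drift and from the compensator of the medium jumps, is
  estimated by absolute values: both turn out to be negligible against \<open>b(t)\<close>. Only the
  quadratic part keeps the direction \<open>z\<close> with an exact constant. After these estimates
  every term is nonnegative and linear in time, so \<open>s\<close> can be replaced by the larger
  \<open>t\<close>.\<close>

lemma levy_projection_tail:
  fixes Pm :: "(real ^ 'd) measure" and X :: "real \<Rightarrow> 'a \<Rightarrow> real ^ 'd"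
  assumes levy: "purely_non_gaussian_levy M X \<gamma> Pm"
    and st: "0 \<le> s" "s \<le> t" and c: "0 < c" "c \<le> 1" and u: "0 \<le> u" and z: "norm z \<le> 1"
  shows "measure M {\<omega>\<in>space M. X s \<omega> \<bullet> z > x}
    \<le> t * measure Pm {y. norm y > c}
      + exp (- (u * x) + u * (t * (norm \<gamma> + (\<integral>y. indicator {y. c < norm y \<and> norm y \<le> 1} y * norm y \<partial>Pm)))
             + u\<^sup>2 / 2 * (t * (\<integral>y. indicator {y. norm y \<le> c} y * (y \<bullet> z)\<^sup>2 \<partial>Pm))
             + u ^ 3 * exp (u * c) * (t * (\<integral>y. indicator {y. norm y \<le> c} y * (norm y * (y \<bullet> z)\<^sup>2) \<partial>Pm)))"
proof -
  have lm: "levy_measure Pm" using levy by (auto simp: purely_non_gaussian_levy_def)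
  define I1 where "I1 = (\<integral>y. indicator {y. c < norm y \<and> norm y \<le> 1} y * norm y \<partial>Pm)"
  define I2 where "I2 = (\<integral>y. indicator {y. norm y \<le> c} y * (y \<bullet> z)\<^sup>2 \<partial>Pm)"
  define I3 where "I3 = (\<integral>y. indicator {y. norm y \<le> c} y * (norm y * (y \<bullet> z)\<^sup>2) \<partial>Pm)"
  define F where "F y = indicator {y. norm y \<le> c} y * (exp (u * (y \<bullet> z)) - 1 - u * (y \<bullet> z))
                       - u * (indicator {y. c < norm y \<and> norm y \<le> 1} y * (y \<bullet> z))" for y :: "real ^ 'd"
  define G where "G y = u * (indicator {y. c < norm y \<and> norm y \<le> 1} y * norm y)
      + u\<^sup>2 / 2 * (indicator {y. norm y \<le> c} y * (y \<bullet> z)\<^sup>2)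
      + u ^ 3 * exp (u * c) * (indicator {y. norm y \<le> c} y * (norm y * (y \<bullet> z)\<^sup>2))" for y :: "real ^ 'd"
  note i = levy_medium_jumps_integrable[OF lm c(1)] levy_truncated_integrable[OF lm c(2), of z]
  have Gi: "integrable Pm G" unfolding G_def by (intro Bochner_Integration.integrable_add integrable_mult_right i)
  have IG: "integral\<^sup>L Pm G = u * I1 + u\<^sup>2 / 2 * I2 + u ^ 3 * exp (u * c) * I3"
    unfolding G_def I1_def I2_def I3_def using i
    by (subst Bochner_Integration.integral_add, simp, simp)+ simp
  have nn: "I1 \<ge> 0" "I2 \<ge> 0" "I3 \<ge> 0"
    unfolding I1_def I2_def I3_def by (intro Bochner_Integration.integral_nonneg; simp)+
  have fb: "\<bar>y \<bullet> z\<bar> \<le> norm y" for y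
    using Cauchy_Schwarz_ineq2[of y z] z mult_left_mono[of "norm z" 1 "norm y"] by simp
  have FG: "F y \<le> G y" for y
  proof -
    have "exp (u * (y \<bullet> z)) - 1 - u * (y \<bullet> z) \<le> u\<^sup>2 / 2 * (y \<bullet> z)\<^sup>2 + u ^ 3 * exp (u * c) * (norm y * (y \<bullet> z)\<^sup>2)"
      if y: "norm y \<le> c"
    proof -
      have "\<bar>u * (y \<bullet> z)\<bar> ^ 3 * exp \<bar>u * (y \<bullet> z)\<bar> = u ^ 3 * (\<bar>y \<bullet> z\<bar> * (y \<bullet> z)\<^sup>2) * exp (u * \<bar>y \<bullet> z\<bar>)"
        using u by (simp add: abs_mult power_mult_distrib eval_nat_numeral)
      also have "\<dots> \<le> u ^ 3 * (norm y * (y \<bullet> z)\<^sup>2) * exp (u * c)"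
        using fb[of y] y u by (intro mult_mono) (auto intro!: mult_mono mult_left_mono)
      finally show ?thesis using exp_third_order[of "u * (y \<bullet> z)"] by (simp add: power_mult_distrib algebra_simps)
    qed
    moreover have "- (u * (y \<bullet> z)) \<le> u * norm y"
    proof -
      have "- (y \<bullet> z) \<le> norm y" using fb[of y] by linarith
      from mult_left_mono[OF this u] show ?thesis by simp
    qed
    ultimately show ?thesis by (auto simp: F_def G_def indicator_def)
  qed
  have IF: "integral\<^sup>L Pm F \<le> u * I1 + u\<^sup>2 / 2 * I2 + u ^ 3 * exp (u * c) * I3"
  proof (cases "integrable Pm F")
    case True
    then show ?thesis unfolding IG[symmetric] using Gi FG by (intro integral_mono) auto
  next
    \<comment> \<open>A non-integrable \<open>F\<close> would have Bochner integral 0 by convention,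
      and the right-hand side is nonnegative.\<close>
    case False
    then show ?thesis using nn u by (simp add: not_integrable_integral_eq)
  qed
  have "measure M {\<omega>\<in>space M. X s \<omega> \<bullet> z > x} \<le> s * measure Pm {y. norm y > c}
      + exp (u * (s * (\<gamma> \<bullet> z) - x) + s * integral\<^sup>L Pm F)"
    unfolding F_def by (rule levy_projection_chernoff[OF levy st(1) c u])
  also have "\<dots> \<le> t * measure Pm {y. norm y > c} + exp (- (u * x) + u * (t * (norm \<gamma> + I1))
      + u\<^sup>2 / 2 * (t * I2) + u ^ 3 * exp (u * c) * (t * I3))"
  proof (intro add_mono)
    show "s * measure Pm {y. norm y > c} \<le> t * measure Pm {y. norm y > c}"
      using st by (intro mult_right_mono) auto
    have "s * (\<gamma> \<bullet> z) \<le> t * norm \<gamma>"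
      using fb[of \<gamma>] st by (intro order_trans[OF mult_left_mono mult_right_mono]) auto
    then have a: "u * (s * (\<gamma> \<bullet> z)) \<le> u * (t * norm \<gamma>)" using u by (rule mult_left_mono)
    have "s * integral\<^sup>L Pm F \<le> s * (u * I1 + u\<^sup>2 / 2 * I2 + u ^ 3 * exp (u * c) * I3)"
      using IF st by (intro mult_left_mono)
    also have "\<dots> \<le> t * (u * I1 + u\<^sup>2 / 2 * I2 + u ^ 3 * exp (u * c) * I3)"
      using nn u st by (intro mult_right_mono) auto
    finally have "u * (s * (\<gamma> \<bullet> z) - x) + s * integral\<^sup>L Pm F \<le> - (u * x) + u * (t * (norm \<gamma> + I1))
      + u\<^sup>2 / 2 * (t * I2) + u ^ 3 * exp (u * c) * (t * I3)"
      using a by (simp add: algebra_simps)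
    then show "exp (u * (s * (\<gamma> \<bullet> z) - x) + s * integral\<^sup>L Pm F) \<le> exp (- (u * x) + u * (t * (norm \<gamma> + I1))
      + u\<^sup>2 / 2 * (t * I2) + u ^ 3 * exp (u * c) * (t * I3))" by simp
  qed
  finally show ?thesis unfolding I1_def I2_def I3_def .
qed

subsection \<open>A maximal inequality\<close>

text \<open>Split according to the first index \<open>i\<close> with \<open>x + y < S i\<close>.
  This event \<open>A i\<close> depends on the increments before \<open>i\<close>, while
  \<open>B i\<close>, that the rest of the walk loses at most \<open>y\<close>, depends on the later
  ones. The two are independent, and together they force \<open>x < S n\<close>.\<close>

lemma (in prob_space) ottaviani:
  fixes S :: "nat \<Rightarrow> 'a \<Rightarrow> real"
  assumes ind: "indep_vars (\<lambda>_. borel) (\<lambda>i \<omega>. S (Suc i) \<omega> - S i \<omega>) {..<n}"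
    and Sm[measurable]: "\<And>i. i \<le> n \<Longrightarrow> S i \<in> borel_measurable M"
    and S0: "\<And>\<omega>. \<omega> \<in> space M \<Longrightarrow> S 0 \<omega> = 0"
    and q: "\<And>i. i \<le> n \<Longrightarrow> q \<le> prob {\<omega>\<in>space M. - y \<le> S n \<omega> - S i \<omega>}"
  shows "q * prob {\<omega>\<in>space M. \<exists>i\<le>n. x + y < S i \<omega>} \<le> prob {\<omega>\<in>space M. x < S n \<omega>}"
proof -
  define \<xi> where "\<xi> i \<omega> = S (Suc i) \<omega> - S i \<omega>" for i \<omega>
  have sum: "S j \<omega> = (\<Sum>k<j. \<xi> k \<omega>)" if "\<omega> \<in> space M" for j \<omega>
    by (induction j) (auto simp: S0[OF that] \<xi>_def)
  have sum2: "S n \<omega> - S j \<omega> = (\<Sum>k=j..<n. \<xi> k \<omega>)" if "j \<le> n" for j \<omega>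
    using that unfolding \<xi>_def by (induction n rule: dec_induct) auto
  define A where "A i = {\<omega>\<in>space M. x + y < S i \<omega> \<and> (\<forall>j<i. S j \<omega> \<le> x + y)}" for i
  define B where "B i = {\<omega>\<in>space M. - y \<le> S n \<omega> - S i \<omega>}" for i
  have Am: "A i \<in> events" if "i \<le> n" for i
  proof -
    have eq: "A i = {\<omega>\<in>space M. x + y < S i \<omega>} \<inter> (space M \<inter> (\<Inter>j\<in>{..<i}. {\<omega>\<in>space M. S j \<omega> \<le> x + y}))"
      by (auto simp: A_def)
    have 1: "{\<omega>\<in>space M. x + y < S i \<omega>} \<in> events" using Sm[OF that] by measurable
    have "{\<omega>\<in>space M. S j \<omega> \<le> x + y} \<in> events" if "j < i" for j
      using Sm[of j] \<open>i \<le> n\<close> that by (auto intro!: borel_measurable_le)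
    then have 2: "space M \<inter> (\<Inter>j\<in>{..<i}. {\<omega>\<in>space M. S j \<omega> \<le> x + y}) \<in> events"
      by (cases "i = 0") (auto intro!: sets.Int sets.finite_INT)
    show ?thesis unfolding eq using 1 2 by (rule sets.Int)
  qed
  have Bm: "B i \<in> events" if "i \<le> n" for i
    using Sm[OF that] Sm[of n] unfolding B_def by measurable
  have AB: "prob (A i \<inter> B i) = prob (A i) * prob (B i)" if i: "i \<le> n" for i
  proof -
    let ?P1 = "PiM {..<i} (\<lambda>_. borel :: real measure)" and ?P2 = "PiM {i..<n} (\<lambda>_. borel :: real measure)"
    let ?r1 = "\<lambda>\<omega>. \<lambda>k\<in>{..<i}. \<xi> k \<omega>" and ?r2 = "\<lambda>\<omega>. \<lambda>k\<in>{i..<n}. \<xi> k \<omega>"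
    have iv: "indep_var ?P1 ?r1 ?P2 ?r2"
      by (rule indep_var_restrict[OF ind[folded \<xi>_def]]) (use i in auto)
    \<comment> \<open>Intersecting with \<open>{..<i}\<close> keeps all coordinates inside the index
      set of the product space, where measurability is available; for \<open>j < i\<close> it
      changes nothing.\<close>
    let ?C = "{v\<in>space ?P1. x + y < (\<Sum>k<i. v k) \<and> (\<forall>j\<in>{..<i}. (\<Sum>k\<in>{..<i} \<inter> {..<j}. v k) \<le> x + y)}"
    let ?D = "{v\<in>space ?P2. - y \<le> (\<Sum>k=i..<n. v k)}"
    have C: "?C \<in> sets ?P1" by measurable
    have D: "?D \<in> sets ?P2" by measurable
    have A: "A i = ?r1 -` ?C \<inter> space M"
    proof -
      have "{..<i} \<inter> {..<j} = {..<j}" if "j < i" for j using that by auto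
      then show ?thesis
        unfolding A_def by (auto simp: sum space_PiM)
    qed
    have B: "B i = ?r2 -` ?D \<inter> space M"
      unfolding B_def using sum2[OF i] by (auto simp: space_PiM)
    have "prob (A i \<inter> B i) = prob ((\<lambda>\<omega>. (?r1 \<omega>, ?r2 \<omega>)) -` (?C \<times> ?D) \<inter> space M)"
      unfolding A B by (rule arg_cong[where f=prob]) auto
    also have "\<dots> = prob (A i) * prob (B i)"
      unfolding A B by (rule indep_varD[OF iv C D])
    finally show ?thesis .
  qed
  have dis: "disjoint_family_on A {..n}"
    unfolding disjoint_family_on_def
  proof (intro ballI impI)
    fix i j :: nat assume "i \<noteq> j"
    have "A i \<inter> A j = {}" if "i < j" for i j
    proof -
      have "\<omega> \<notin> A j" if "\<omega> \<in> A i" for \<omega>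
        using \<open>i < j\<close> that unfolding A_def by (auto simp: not_less[symmetric])
      then show ?thesis by auto
    qed
    from this[of i j] this[of j i] \<open>i \<noteq> j\<close> show "A i \<inter> A j = {}" by (metis Int_commute nat_neq_iff)
  qed
  have un: "{\<omega>\<in>space M. \<exists>i\<le>n. x + y < S i \<omega>} = (\<Union>i\<le>n. A i)"
  proof (intro equalityI subsetI)
    fix \<omega> assume "\<omega> \<in> {\<omega>\<in>space M. \<exists>i\<le>n. x + y < S i \<omega>}"
    then have w: "\<omega> \<in> space M" and ex: "\<exists>i. i \<le> n \<and> x + y < S i \<omega>" by auto
    define i where "i = (LEAST i. i \<le> n \<and> x + y < S i \<omega>)"
    have "i \<le> n \<and> x + y < S i \<omega>" unfolding i_def by (rule LeastI_ex[OF ex])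
    moreover have "S j \<omega> \<le> x + y" if "j < i" for j
      using not_less_Least[OF that[unfolded i_def]] calculation that by auto
    ultimately show "\<omega> \<in> (\<Union>i\<le>n. A i)" using w by (auto simp: A_def)
  qed (auto simp: A_def)
  have "prob {\<omega>\<in>space M. \<exists>i\<le>n. x + y < S i \<omega>} = (\<Sum>i\<le>n. prob (A i))"
    unfolding un by (rule finite_measure_finite_Union) (use Am dis in auto)
  then have "q * prob {\<omega>\<in>space M. \<exists>i\<le>n. x + y < S i \<omega>} = (\<Sum>i\<le>n. prob (A i) * q)"
    by (simp add: sum_distrib_left mult.commute)
  also have "\<dots> \<le> (\<Sum>i\<le>n. prob (A i) * prob (B i))"
    using q by (intro sum_mono mult_left_mono) (auto simp: B_def)
  also have "\<dots> = (\<Sum>i\<le>n. prob (A i \<inter> B i))" using AB by simp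
  also have "\<dots> = prob (\<Union>i\<le>n. A i \<inter> B i)"
  proof (rule finite_measure_finite_Union[symmetric])
    show "disjoint_family_on (\<lambda>i. A i \<inter> B i) {..n}"
      using dis unfolding disjoint_family_on_def by blast
  qed (use Am Bm in auto)
  also have "\<dots> \<le> prob {\<omega>\<in>space M. x < S n \<omega>}"
    by (rule finite_measure_mono) (auto simp: A_def B_def)
  finally show ?thesis .
qed

text \<open>A strict exceedance at \<open>s < t\<close> persists on an interval to the right of
  \<open>s\<close>, which meets a sufficiently fine dyadic grid of \<open>[0, t]\<close>. The
  endpoint \<open>s = t\<close> has no such interval inside \<open>[0, t]\<close>, but lies on every
  grid.\<close>

lemma right_continuous_dyadic_exceeds:
  fixes g :: "real \<Rightarrow> real"
  assumes t: "0 < t" and s: "0 \<le> s" "s \<le> t" and g: "a < g s" and rc: "continuous (at_right s) g"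
  obtains k i where "i \<le> 2 ^ k" "a < g (t * (real i / 2 ^ k))"
proof (cases "s = t")
  case True
  then show ?thesis using that[of 1 0] g by simp
next
  case False
  have "(g \<longlongrightarrow> g s) (at_right s)" using rc by (simp add: continuous_within)
  then have "\<forall>\<^sub>F r in at_right s. a < g r" using g by (rule order_tendstoD(1))
  then obtain e where e: "s < e" "\<And>r. s < r \<Longrightarrow> r < e \<Longrightarrow> a < g r"
    unfolding eventually_at_right_field by blast
  define d where "d = (min e t - s) / t"
  have d: "d > 0" using e False s t by (simp add: d_def)
  then obtain k where k: "1 / 2 ^ k < d"
    using real_arch_pow_inv[of d "1/2"] by (auto simp: power_one_over)
  \<comment> \<open>This is the first grid index strictly to the right of \<open>s\<close>; the mesh
    below \<open>d\<close> keeps its grid point before both \<open>e\<close> and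
    \<open>t\<close>.\<close>
  define i where "i = nat (\<lfloor>s / t * 2 ^ k\<rfloor> + 1)"
  have st: "0 \<le> s / t * 2 ^ k" using s t by simp
  have ri: "real i = real_of_int \<lfloor>s / t * 2 ^ k\<rfloor> + 1" using st unfolding i_def by simp
  have l: "s / t * 2 ^ k < real i" "real i \<le> s / t * 2 ^ k + 1" unfolding ri by linarith+
  have "s / t < real i / 2 ^ k" using l(1) by (simp add: field_simps)
  then have r1: "s < t * (real i / 2 ^ k)" using t by (simp add: field_simps)
  have "real i / 2 ^ k \<le> s / t + 1 / 2 ^ k" using l(2) by (simp add: field_simps)
  also have "\<dots> < s / t + d" using k by simp
  also have "\<dots> = min e t / t" using t by (simp add: d_def field_simps)
  finally have r2: "t * (real i / 2 ^ k) < min e t" using t by (simp add: pos_less_divide_eq mult.commute)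
  then have "t * (real i / 2 ^ k) < t * 1" by simp
  then have "real i / 2 ^ k < 1" using t by (simp only: mult_less_cancel_left_pos)
  then have "real i < real (2 ^ k)" by simp
  then have "i \<le> 2 ^ k" by (simp only: of_nat_less_iff less_imp_le)
  then show ?thesis using that[of i k] e(2)[OF r1] r2 by simp
qed

text \<open>\<open>E\<close> is the increasing union of the exceedance events over dyadic grids,
  each bounded by Ottaviani's inequality with \<open>q = 1 / 2\<close>. It catches every
  right-continuous path that exceeds the level, so measurability of the supremum itself never
  enters. The assumption on \<open>- z\<close> controls the remaining increment through
  stationarity.\<close>

lemma levy_maximal_inequality:
  fixes Pm :: "(real ^ 'd) measure" and X :: "real \<Rightarrow> 'a \<Rightarrow> real ^ 'd"
  assumes levy: "purely_non_gaussian_levy M X \<gamma> Pm" and t: "0 < t"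
    and small: "\<And>s. 0 \<le> s \<Longrightarrow> s \<le> t \<Longrightarrow> measure M {\<omega>\<in>space M. y < X s \<omega> \<bullet> (- z)} \<le> 1 / 2"
  obtains E where "E \<in> sets M" "measure M E \<le> 2 * measure M {\<omega>\<in>space M. x < X t \<omega> \<bullet> z}"
    "\<And>\<omega> s. \<omega> \<in> space M \<Longrightarrow> (\<And>s. 0 \<le> s \<Longrightarrow> continuous (at_right s) (\<lambda>s. X s \<omega>)) \<Longrightarrow>
      0 \<le> s \<Longrightarrow> s \<le> t \<Longrightarrow> x + y < X s \<omega> \<bullet> z \<Longrightarrow> \<omega> \<in> E"
proof -
  have "prob_space M" and Xm: "\<And>t. 0 \<le> t \<Longrightarrow> X t \<in> borel_measurable M"
    and X0: "\<And>\<omega>. \<omega> \<in> space M \<Longrightarrow> X 0 \<omega> = 0"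
    and ind: "\<And>ts n. 0 \<le> ts 0 \<Longrightarrow> (\<And>i. ts i \<le> ts (Suc i)) \<Longrightarrow>
      prob_space.indep_vars M (\<lambda>_. borel) (\<lambda>i \<omega>. X (ts (Suc i)) \<omega> - X (ts i) \<omega>) {..<n::nat}"
    and stat: "\<And>s t. 0 \<le> s \<Longrightarrow> 0 \<le> t \<Longrightarrow> distr M borel (\<lambda>\<omega>. X (s + t) \<omega> - X s \<omega>) = distr M borel (X t)"
    using levy unfolding purely_non_gaussian_levy_def by blast+
  interpret prob_space M by fact
  define g where "g k i = t * (real i / 2 ^ k)" for k i :: nat
  have g0: "0 \<le> g k i" for k i using t by (simp add: g_def)
  have gt: "g k i \<le> t" if "i \<le> 2 ^ k" for k i
  proof -
    have "real i \<le> real (2 ^ k)" using that by (simp only: of_nat_le_iff)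
    then have "t * (real i / 2 ^ k) \<le> t * 1" using t by (intro mult_left_mono) auto
    then show ?thesis by (simp add: g_def)
  qed
  define E where "E k = {\<omega>\<in>space M. \<exists>i\<le>2 ^ k. x + y < X (g k i) \<omega> \<bullet> z}" for k
  have Ym: "(\<lambda>\<omega>. X (g k i) \<omega> \<bullet> z) \<in> borel_measurable M" for k i
    using Xm[OF g0] by measurable
  have Em[measurable]: "E k \<in> events" for k
  proof -
    have "E k = (\<Union>i\<le>2 ^ k. {\<omega>\<in>space M. x + y < X (g k i) \<omega> \<bullet> z})" by (auto simp: E_def)
    moreover have "{\<omega>\<in>space M. x + y < X (g k i) \<omega> \<bullet> z} \<in> events" for i using Ym by measurable
    ultimately show ?thesis by auto
  qed
  have Ek: "prob (E k) \<le> 2 * prob {\<omega>\<in>space M. x < X t \<omega> \<bullet> z}" for k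
  proof -
    let ?S = "\<lambda>i \<omega>. X (g k i) \<omega> \<bullet> z"
    have "1 / 2 * prob {\<omega>\<in>space M. \<exists>i\<le>2 ^ k. x + y < ?S i \<omega>} \<le> prob {\<omega>\<in>space M. x < ?S (2 ^ k) \<omega>}"
    proof (rule ottaviani)
      have "indep_vars (\<lambda>_. borel) (\<lambda>i \<omega>. X (g k (Suc i)) \<omega> - X (g k i) \<omega>) {..<2 ^ k}"
        by (rule ind) (use t in \<open>auto simp: g_def divide_simps\<close>)
      then have "indep_vars (\<lambda>_. borel) (\<lambda>i \<omega>. (X (g k (Suc i)) \<omega> - X (g k i) \<omega>) \<bullet> z) {..<2 ^ k}"
        by (rule indep_vars_compose2) simp
      then show "indep_vars (\<lambda>_. borel) (\<lambda>i \<omega>. X (g k (Suc i)) \<omega> \<bullet> z - X (g k i) \<omega> \<bullet> z) {..<2 ^ k}"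
        by (simp add: inner_diff_left)
      show "X (g k 0) \<omega> \<bullet> z = 0" if "\<omega> \<in> space M" for \<omega> using X0[OF that] by (simp add: g_def)
      fix i :: nat assume i: "i \<le> 2 ^ k"
      define s where "s = t - g k i"
      have s: "0 \<le> s" "s \<le> t" using gt[OF i] g0[of k i] by (auto simp: s_def)
      have gk: "g k (2 ^ k) = g k i + s" by (simp add: g_def s_def)
      let ?H = "{v :: real ^ 'd. - y \<le> v \<bullet> z}"
      have H: "?H \<in> sets borel" by measurable
      have m: "(\<lambda>\<omega>. X (g k i + s) \<omega> - X (g k i) \<omega>) \<in> borel_measurable M"
        using Xm[OF g0[of k i]] Xm[of "g k i + s"] g0[of k i] s by simp
      have "prob {\<omega>\<in>space M. - y \<le> X (g k (2 ^ k)) \<omega> \<bullet> z - X (g k i) \<omega> \<bullet> z}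
        = measure (distr M borel (\<lambda>\<omega>. X (g k i + s) \<omega> - X (g k i) \<omega>)) ?H"
        unfolding gk using m H by (subst measure_distr) (auto simp: inner_diff_left intro!: arg_cong[where f=prob])
      also have "\<dots> = measure (distr M borel (X s)) ?H" using stat[OF g0 s(1)] by simp
      also have "\<dots> = prob {\<omega>\<in>space M. - y \<le> X s \<omega> \<bullet> z}"
        using Xm[OF s(1)] H by (subst measure_distr) (auto intro!: arg_cong[where f=prob])
      \<comment> \<open>The complementary event is a tail event in the direction \<open>- z\<close>,
        which brings in the assumption \<open>small\<close>.\<close>
      also have "\<dots> = 1 - prob {\<omega>\<in>space M. y < X s \<omega> \<bullet> (- z)}"
      proof -
        have m: "{\<omega>\<in>space M. y < X s \<omega> \<bullet> (- z)} \<in> events" using Xm[OF s(1)] by measurable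
        have "{\<omega>\<in>space M. - y \<le> X s \<omega> \<bullet> z} = space M - {\<omega>\<in>space M. y < X s \<omega> \<bullet> (- z)}" by auto
        then show ?thesis using prob_compl[OF m] by simp
      qed
      also have "\<dots> \<ge> 1 / 2" using small[OF s] by simp
      finally show "1 / 2 \<le> prob {\<omega>\<in>space M. - y \<le> X (g k (2 ^ k)) \<omega> \<bullet> z - X (g k i) \<omega> \<bullet> z}" .
    qed (rule Ym)
    then show ?thesis by (simp add: E_def g_def)
  qed
  have inc: "incseq E"
  proof (rule incseq_SucI)
    fix k
    have g2: "g k i = g (Suc k) (2 * i)" for i by (simp add: g_def)
    then show "E k \<subseteq> E (Suc k)" unfolding E_def
    proof safe
      fix \<omega> i assume i: "i \<le> 2 ^ k" and x: "x + y < X (g k i) \<omega> \<bullet> z"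
      then have "2 * i \<le> 2 ^ Suc k" by simp
      then show "\<exists>j\<le>2 ^ Suc k. x + y < X (g (Suc k) j) \<omega> \<bullet> z"
        using x g2 by metis
    qed
  qed
  have "(\<lambda>k. prob (E k)) \<longlonglongrightarrow> prob (\<Union>k. E k)"
    by (rule finite_Lim_measure_incseq) (use inc in auto)
  then have le: "prob (\<Union>k. E k) \<le> 2 * prob {\<omega>\<in>space M. x < X t \<omega> \<bullet> z}"
    by (rule LIMSEQ_le_const2) (use Ek in auto)
  have mem: "\<omega> \<in> (\<Union>k. E k)"
    if w: "\<omega> \<in> space M" "\<And>s. 0 \<le> s \<Longrightarrow> continuous (at_right s) (\<lambda>s. X s \<omega>)"
      and s: "0 \<le> s" "s \<le> t" "x + y < X s \<omega> \<bullet> z" for \<omega> s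
  proof -
    have "continuous (at_right s) (\<lambda>s. X s \<omega> \<bullet> z)" using w(2)[OF s(1)] by (intro continuous_intros)
    then obtain k i where "i \<le> 2 ^ k" "x + y < X (t * (real i / 2 ^ k)) \<omega> \<bullet> z"
      using right_continuous_dyadic_exceeds[where g="\<lambda>s. X s \<omega> \<bullet> z", OF t s] by blast
    then show ?thesis using w(1) unfolding E_def g_def by blast
  qed
  show ?thesis by (rule that[OF _ le mem]) auto
qed

subsection \<open>Truncated moments along geometric scales\<close>

text \<open>The parameter is the smaller of the Gaussian optimum \<open>\<kappa> / g\<close> and of
  \<open>(2 / \<kappa>) ln (1 / \<beta>)\<close>, beyond which the third-order term is no longer bounded.\<close>
lemma chernoff_parameter:
  fixes \<kappa> \<delta> g \<beta> :: real
  assumes \<kappa>: "0 < \<kappa>" and \<delta>: "0 < \<delta>" "4 * \<delta> \<le> \<kappa>" and g: "0 < g" and \<beta>: "0 \<le> \<beta>" "\<beta> < 1"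
  obtains w where "0 \<le> w"
    "exp (- (\<kappa> * w) + w\<^sup>2 / 2 * g + w ^ 3 * exp (\<delta> * w) * \<beta>) \<le> exp (27 / \<delta> ^ 3) * (exp (- (\<kappa>\<^sup>2 / (2 * g))) + \<beta>)"
proof -
  have opt: "- (\<kappa> * (\<kappa> / g)) + (\<kappa> / g)\<^sup>2 / 2 * g = - (\<kappa>\<^sup>2 / (2 * g))"
    using g by (simp add: power2_eq_square field_simps)
  have pos: "1 \<le> exp (27 / \<delta> ^ 3)" using \<delta> by simp
  have third: "w ^ 3 * exp (\<delta> * w) * \<beta> \<le> 27 / \<delta> ^ 3"
    if w: "0 \<le> w" "w \<le> 2 / \<kappa> * ln (1 / \<beta>)" and b: "0 < \<beta>" for w
  proof -
    \<comment> \<open>Cubing \<open>x / 3 \<le> exp (x / 3)\<close> trades \<open>w ^ 3\<close> for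
      a second factor \<open>exp (\<delta> * w)\<close>; this is the origin of
      \<open>27 / \<delta> ^ 3\<close>. The restriction on \<open>w\<close> and
      \<open>4 * \<delta> \<le> \<kappa>\<close> then make
      \<open>exp (2 * \<delta> * w) * \<beta>\<close> at most 1.\<close>
    have "\<delta> * w / 3 \<le> exp (\<delta> * w / 3)" using exp_ge_add_one_self[of "\<delta> * w / 3"] by linarith
    then have "(\<delta> * w / 3) ^ 3 \<le> exp (\<delta> * w / 3) ^ 3" using w \<delta> by (intro power_mono) auto
    also have "\<dots> = exp (\<delta> * w)" by (simp flip: exp_of_nat_mult)
    finally have "(\<delta> * w) ^ 3 / 27 \<le> exp (\<delta> * w)" by (simp add: power_divide)
    then have "w ^ 3 \<le> 27 / \<delta> ^ 3 * exp (\<delta> * w)"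
      using \<delta> by (simp add: power_mult_distrib field_simps eval_nat_numeral)
    then have "w ^ 3 * exp (\<delta> * w) * \<beta> \<le> 27 / \<delta> ^ 3 * exp (\<delta> * w) * exp (\<delta> * w) * \<beta>"
      using b by (intro mult_right_mono) auto
    also have "\<dots> = 27 / \<delta> ^ 3 * (exp (2 * \<delta> * w) * \<beta>)"
      by (simp add: mult_exp_exp)
    finally have 1: "w ^ 3 * exp (\<delta> * w) * \<beta> \<le> 27 / \<delta> ^ 3 * (exp (2 * \<delta> * w) * \<beta>)" .
    have "2 * \<delta> * w \<le> 2 * \<delta> * (2 / \<kappa> * ln (1 / \<beta>))" using w \<delta> by (intro mult_left_mono) auto
    also have "\<dots> = 4 * \<delta> / \<kappa> * ln (1 / \<beta>)" by simp
    also have "\<dots> \<le> 1 * ln (1 / \<beta>)" using \<delta> \<kappa> b \<beta> by (intro mult_right_mono) auto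
    finally have "exp (2 * \<delta> * w) \<le> exp (ln (1 / \<beta>))" by (simp only: exp_le_cancel_iff mult_1)
    also have "\<dots> = 1 / \<beta>" using b by simp
    finally have "exp (2 * \<delta> * w) * \<beta> \<le> 1" using b by (simp add: field_simps)
    then have "27 / \<delta> ^ 3 * (exp (2 * \<delta> * w) * \<beta>) \<le> 27 / \<delta> ^ 3 * 1"
      using \<delta> by (intro mult_left_mono) auto
    with 1 show ?thesis by simp
  qed
  show ?thesis
  proof (cases "\<beta> = 0")
    case True
    have "exp (- (\<kappa> * (\<kappa> / g)) + (\<kappa> / g)\<^sup>2 / 2 * g) \<le> exp (27 / \<delta> ^ 3) * exp (- (\<kappa>\<^sup>2 / (2 * g)))"
      unfolding opt using mult_right_mono[OF pos, of "exp (- (\<kappa>\<^sup>2 / (2 * g)))"] by simp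
    then show ?thesis using True \<kappa> g by (intro that[of "\<kappa> / g"]) auto
  next
    case False
    then have b: "0 < \<beta>" using \<beta> by simp
    define a where "a = 2 / \<kappa> * ln (1 / \<beta>)"
    have a: "0 \<le> a" using \<kappa> b \<beta> by (simp add: a_def)
    show ?thesis
    proof (cases "\<kappa> / g \<le> a")
      case True
      have "- (\<kappa> * (\<kappa> / g)) + (\<kappa> / g)\<^sup>2 / 2 * g + (\<kappa> / g) ^ 3 * exp (\<delta> * (\<kappa> / g)) * \<beta>
          \<le> - (\<kappa>\<^sup>2 / (2 * g)) + 27 / \<delta> ^ 3"
        unfolding opt using third[of "\<kappa> / g"] True b \<kappa> g by (simp add: a_def)
      then have "exp (- (\<kappa> * (\<kappa> / g)) + (\<kappa> / g)\<^sup>2 / 2 * g + (\<kappa> / g) ^ 3 * exp (\<delta> * (\<kappa> / g)) * \<beta>)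
          \<le> exp (- (\<kappa>\<^sup>2 / (2 * g)) + 27 / \<delta> ^ 3)" by (simp only: exp_le_cancel_iff)
      also have "\<dots> = exp (27 / \<delta> ^ 3) * exp (- (\<kappa>\<^sup>2 / (2 * g)))" by (simp only: exp_add mult.commute)
      also have "\<dots> \<le> exp (27 / \<delta> ^ 3) * (exp (- (\<kappa>\<^sup>2 / (2 * g))) + \<beta>)" using b by simp
      finally show ?thesis using \<kappa> g by (intro that[of "\<kappa> / g"]) auto
    next
      case False
      \<comment> \<open>Stopping before the Gaussian optimum lets the quadratic term use up at most
        half of the linear one; the other half equals \<open>ln \<beta>\<close> by the choice of
        \<open>a\<close>.\<close>
      have "a * g \<le> \<kappa>" using False g by (simp add: field_simps)
      then have "a\<^sup>2 / 2 * g \<le> \<kappa> * a / 2"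
        using mult_right_mono[of "a * g" \<kappa> a] a by (simp add: power2_eq_square algebra_simps)
      moreover have "\<kappa> * a / 2 = - ln \<beta>" using \<kappa> b by (simp add: a_def ln_div)
      ultimately have "- (\<kappa> * a) + a\<^sup>2 / 2 * g + a ^ 3 * exp (\<delta> * a) * \<beta> \<le> ln \<beta> + 27 / \<delta> ^ 3"
        using third[of a] a b by (simp add: a_def)
      then have "exp (- (\<kappa> * a) + a\<^sup>2 / 2 * g + a ^ 3 * exp (\<delta> * a) * \<beta>) \<le> exp (ln \<beta> + 27 / \<delta> ^ 3)"
        by (simp only: exp_le_cancel_iff)
      also have "\<dots> = exp (27 / \<delta> ^ 3) * \<beta>" using b by (simp add: exp_add)
      also have "\<dots> \<le> exp (27 / \<delta> ^ 3) * (exp (- (\<kappa>\<^sup>2 / (2 * g))) + \<beta>)" by simp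
      finally show ?thesis using a by (intro that[of a]) auto
    qed
  qed
qed

text \<open>For each \<open>\<eta> > 0\<close> eventually \<open>e n < \<eta> * (1 - q)\<close>, and
  then the shifted sequence \<open>d n - \<eta>\<close> satisfies the recursion without error
  term.\<close>

lemma contracting_recursion_tendsto_0:
  fixes d e :: "nat \<Rightarrow> real"
  assumes q: "0 \<le> q" "q < 1" and d: "\<And>n. 0 \<le> d n" and e: "e \<longlonglongrightarrow> 0"
    and rec: "\<forall>\<^sub>F n in sequentially. d (Suc n) \<le> q * d n + e n"
  shows "d \<longlonglongrightarrow> 0"
proof (rule LIMSEQ_I)
  fix \<epsilon> :: real assume "0 < \<epsilon>"
  define \<eta> where "\<eta> = \<epsilon> / 2"
  have \<eta>: "0 < \<eta>" using \<open>0 < \<epsilon>\<close> by (simp add: \<eta>_def)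
  have "\<forall>\<^sub>F n in sequentially. e n < \<eta> * (1 - q)"
    using e q \<eta> by (intro order_tendstoD(2)[OF e]) simp
  with rec have "\<forall>\<^sub>F n in sequentially. d (Suc n) - \<eta> \<le> q * (d n - \<eta>)"
    by eventually_elim (simp add: algebra_simps)
  then obtain N where N: "\<And>n. n \<ge> N \<Longrightarrow> d (Suc n) - \<eta> \<le> q * (d n - \<eta>)"
    by (auto simp: eventually_sequentially)
  have le: "d (N + n) - \<eta> \<le> q ^ n * \<bar>d N - \<eta>\<bar>" for n
  proof (induction n)
    case (Suc n)
    have "d (N + Suc n) - \<eta> \<le> q * (d (N + n) - \<eta>)" using N[of "N + n"] by simp
    also have "\<dots> \<le> q * (q ^ n * \<bar>d N - \<eta>\<bar>)" using Suc q by (intro mult_left_mono)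
    finally show ?case by simp
  qed simp
  have "(\<lambda>n. q ^ n * \<bar>d N - \<eta>\<bar>) \<longlonglongrightarrow> 0 * \<bar>d N - \<eta>\<bar>"
    using q by (intro tendsto_mult LIMSEQ_power_zero) auto
  then have "\<forall>\<^sub>F n in sequentially. q ^ n * \<bar>d N - \<eta>\<bar> < \<eta>"
    using \<eta> by (intro order_tendstoD(2)) auto
  then obtain K where K: "\<And>n. n \<ge> K \<Longrightarrow> q ^ n * \<bar>d N - \<eta>\<bar> < \<eta>"
    by (auto simp: eventually_sequentially)
  show "\<exists>no. \<forall>n\<ge>no. norm (d n - 0) < \<epsilon>"
  proof (intro exI allI impI)
    fix n assume "N + K \<le> n"
    then have "d (N + (n - N)) - \<eta> < \<eta>" using le[of "n - N"] K[of "n - N"] by linarith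
    then show "norm (d n - 0) < \<epsilon>" using d[of n] \<open>N + K \<le> n\<close> by (simp add: \<eta>_def)
  qed
qed

text \<open>Summing the recursion bounds a partial sum by \<open>q\<close> times itself plus a
  boundary term and the sum of \<open>p\<close>; since \<open>q < 1\<close>, it can be solved for.
  The bound \<open>K\<close> controls the boundary term and excludes solutions growing like
  \<open>q ^ (- n)\<close>.\<close>

lemma backward_recursion_summable:
  fixes \<beta> p :: "nat \<Rightarrow> real"
  assumes q: "0 \<le> q" "q < 1" and \<beta>: "\<And>n. 0 \<le> \<beta> n" and p: "\<And>n. 0 \<le> p n" "summable p"
    and bnd: "\<forall>\<^sub>F n in sequentially. \<beta> n \<le> K"
    and rec: "\<forall>\<^sub>F n in sequentially. \<beta> n \<le> q * \<beta> (Suc n) + p n"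
  shows "summable \<beta>"
proof -
  from eventually_conj[OF bnd rec] obtain N where
    N: "\<And>n. n \<ge> N \<Longrightarrow> \<beta> n \<le> K" "\<And>n. n \<ge> N \<Longrightarrow> \<beta> n \<le> q * \<beta> (Suc n) + p n"
    by (auto simp: eventually_sequentially)
  have ps: "summable (\<lambda>n. p (n + N))" using p(2) by (rule summable_ignore_initial_segment)
  define P where "P = (\<Sum>n. p (n + N))"
  have "summable (\<lambda>n. \<beta> (n + N))"
  proof (rule summableI_nonneg_bounded)
    fix m
    let ?S = "\<Sum>n<m. \<beta> (n + N)"
    have "?S \<le> (\<Sum>n<m. q * \<beta> (Suc n + N) + p (n + N))" using N(2) by (intro sum_mono) simp
    also have "\<dots> = q * (\<Sum>n<m. \<beta> (Suc n + N)) + (\<Sum>n<m. p (n + N))"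
      by (simp add: sum.distrib sum_distrib_left)
    also have "(\<Sum>n<m. p (n + N)) \<le> P" unfolding P_def using ps p(1) by (intro sum_le_suminf) auto
    also have "(\<Sum>n<m. \<beta> (Suc n + N)) \<le> ?S + K"
    proof -
      have "(\<Sum>n<Suc m. \<beta> (n + N)) = \<beta> (0 + N) + (\<Sum>n<m. \<beta> (Suc n + N))" by (rule sum.lessThan_Suc_shift)
      then show ?thesis using \<beta>[of N] N(1)[of "m + N"] by simp
    qed
    finally have "?S \<le> q * (?S + K) + P" using q by (simp add: mult_left_mono)
    then have "(1 - q) * ?S \<le> q * K + P" by (simp add: algebra_simps)
    then show "?S \<le> (q * K + P) / (1 - q)" using q by (simp add: pos_le_divide_eq mult.commute)
  qed (rule \<beta>)
  then show ?thesis by (simp only: summable_iff_shift)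
qed

text \<open>Geometric times \<open>T\<close> with jump cuts \<open>c\<close>. Regular variation of
  order 1/2 enters only through the limit in \<open>c_ratio\<close>. The cuts stay abstract so that
  they can be taken as \<open>\<delta> * b (T n)\<close> for any
  \<open>\<delta> > 0\<close>.\<close>

locale levy_scales =
  fixes Pm :: "(real ^ 'd) measure" and r :: real and T c :: "nat \<Rightarrow> real"
  assumes lm: "levy_measure Pm" and r: "0 < r" "r < 1"
    and T_pos: "\<And>n. 0 < T n" and T_Suc: "\<And>n. T (Suc n) = r * T n"
    and c_pos: "\<And>n. 0 < c n" and c_Suc: "\<And>n. c (Suc n) \<le> c n"
    and c_ratio: "(\<lambda>n. c (Suc n) / c n) \<longlonglongrightarrow> sqrt r"
    and tails: "summable (\<lambda>n. T n * measure Pm {y. norm y > c n})"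
begin

text \<open>The two quotients are the limiting contraction factors of the recursions below:
  \<open>r / sqrt r\<close> for quantities scaled by \<open>T / c\<close>, and
  \<open>sqrt r ^ 3 / r\<close> for the third moment run backward.\<close>

lemma sqrt_r: "0 < sqrt r" "sqrt r < 1" "r / sqrt r = sqrt r" "sqrt r ^ 3 / r = sqrt r"
  using r by (auto simp: real_div_sqrt power3_eq_cube)

lemma c_ratio_inverse: "(\<lambda>n. r * (c n / c (Suc n))) \<longlonglongrightarrow> sqrt r"
proof -
  have "(\<lambda>n. r / (c (Suc n) / c n)) \<longlonglongrightarrow> r / sqrt r"
    by (intro tendsto_intros c_ratio) (use sqrt_r in auto)
  then show ?thesis using sqrt_r by simp
qed

text \<open>The midpoint between \<open>sqrt r\<close> and 1: ratios tending to
  \<open>sqrt r\<close> are eventually below \<open>q\<close>, and \<open>q\<close> still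
  contracts.\<close>

definition q where "q = (1 + sqrt r) / 2"

lemma q: "0 \<le> q" "q < 1" "sqrt r < q" using sqrt_r by (auto simp: q_def)

lemma c_tendsto_0: "c \<longlonglongrightarrow> 0"
proof (rule contracting_recursion_tendsto_0[OF q(1,2), where e="\<lambda>_. 0"])
  show "0 \<le> c n" for n using c_pos[of n] by simp
  have "\<forall>\<^sub>F n in sequentially. c (Suc n) / c n < q" using c_ratio q(3) by (rule order_tendstoD)
  then show "\<forall>\<^sub>F n in sequentially. c (Suc n) \<le> q * c n + 0"
    by eventually_elim (use c_pos in \<open>simp add: pos_divide_less_eq\<close>)
qed simp

lemma T_over_c_tendsto_0: "(\<lambda>n. T n / c n) \<longlonglongrightarrow> 0"
proof (rule contracting_recursion_tendsto_0[OF q(1,2), where e="\<lambda>_. 0"])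
  show "0 \<le> T n / c n" for n using c_pos[of n] T_pos[of n] by simp
  have "\<forall>\<^sub>F n in sequentially. r * (c n / c (Suc n)) < q" using c_ratio_inverse q(3) by (rule order_tendstoD)
  then show "\<forall>\<^sub>F n in sequentially. T (Suc n) / c (Suc n) \<le> q * (T n / c n) + 0"
  proof eventually_elim
    case (elim n)
    have "T (Suc n) / c (Suc n) = r * (c n / c (Suc n)) * (T n / c n)"
      using c_pos[of n] by (simp add: T_Suc)
    also have "\<dots> \<le> q * (T n / c n)" using elim c_pos[of n] T_pos[of n] by (intro mult_right_mono) auto
    finally show ?case by simp
  qed
qed simp

lemma jumps_integrable: "0 < a \<Longrightarrow> integrable Pm (indicator {y. norm y > a} :: _ \<Rightarrow> real)"
  by (rule levy_measure_integrable_outside_ball[OF lm, where c=a and K=1]) (auto simp: indicator_def)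

lemma space_Pm: "space Pm = UNIV"
  using lm sets_eq_imp_space_eq[of Pm borel] by (simp add: levy_measure_def)

text \<open>Passing to the next scale multiplies \<open>T / c\<close> by a factor tending to
  \<open>sqrt r\<close> and enlarges the domain by part of the shell
  \<open>c (Suc n) < norm y \<le> c n\<close>. Jumps there have norm at most \<open>c n\<close>, so
  the addition is a multiple of \<open>T * tail\<close> at scale \<open>Suc n\<close>, which tends
  to 0.\<close>

lemma medium_jumps_tendsto_0:
  "(\<lambda>n. T n * (\<integral>y. indicator {y. c n < norm y \<and> norm y \<le> 1} y * norm y \<partial>Pm) / c n) \<longlonglongrightarrow> 0"
    (is "(\<lambda>n. T n * ?D n / c n) \<longlonglongrightarrow> 0")
proof (rule contracting_recursion_tendsto_0[OF q(1,2)])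
  let ?tail = "\<lambda>n. measure Pm {y. norm y > c n}"
  show "0 \<le> T n * ?D n / c n" for n
    using c_pos[of n] T_pos[of n] by (simp add: Bochner_Integration.integral_nonneg)
  have "(\<lambda>n. T (Suc n) * ?tail (Suc n)) \<longlonglongrightarrow> 0"
    using summable_LIMSEQ_zero[OF tails] by (rule LIMSEQ_Suc)
  then have "(\<lambda>n. r * (c n / c (Suc n)) * (T (Suc n) * ?tail (Suc n)) / r) \<longlonglongrightarrow> sqrt r * 0 / r"
    using r by (intro tendsto_intros c_ratio_inverse) auto
  then show "(\<lambda>n. r * (c n / c (Suc n)) * (T (Suc n) * ?tail (Suc n)) / r) \<longlonglongrightarrow> 0" by simp
  have "\<forall>\<^sub>F n in sequentially. r * (c n / c (Suc n)) < q" using c_ratio_inverse q(3) by (rule order_tendstoD)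
  then show "\<forall>\<^sub>F n in sequentially. T (Suc n) * ?D (Suc n) / c (Suc n)
      \<le> q * (T n * ?D n / c n) + r * (c n / c (Suc n)) * (T (Suc n) * ?tail (Suc n)) / r"
  proof eventually_elim
    case (elim n)
    have D0: "0 \<le> ?D n" by (intro Bochner_Integration.integral_nonneg) simp
    have "?D (Suc n) \<le> (\<integral>y. indicator {y. c n < norm y \<and> norm y \<le> 1} y * norm y
        + c n * indicator {y. norm y > c (Suc n)} y \<partial>Pm)"
    proof (rule integral_mono)
      show "indicator {y. c (Suc n) < norm y \<and> norm y \<le> 1} y * norm y
         \<le> indicator {y. c n < norm y \<and> norm y \<le> 1} y * norm y + c n * indicator {y. norm y > c (Suc n)} y"
        for y :: "real ^ 'd"
        using c_pos[of n] by (auto simp: indicator_def)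
    qed (use levy_medium_jumps_integrable[OF lm c_pos] jumps_integrable[OF c_pos] in auto)
    also have "\<dots> = ?D n + c n * ?tail (Suc n)"
      using levy_medium_jumps_integrable[OF lm c_pos[of n]] jumps_integrable[OF c_pos[of "Suc n"]]
      by (subst Bochner_Integration.integral_add) (auto simp: space_Pm)
    finally have "T (Suc n) * ?D (Suc n) / c (Suc n) \<le> T (Suc n) * (?D n + c n * ?tail (Suc n)) / c (Suc n)"
      using T_pos[of "Suc n"] c_pos[of "Suc n"] by (intro divide_right_mono mult_left_mono) auto
    also have "\<dots> = r * (c n / c (Suc n)) * (T n * ?D n / c n) + r * (c n / c (Suc n)) * (T (Suc n) * ?tail (Suc n)) / r"
      using c_pos[of n] c_pos[of "Suc n"] r by (simp add: T_Suc field_simps)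
    also have "\<dots> \<le> q * (T n * ?D n / c n) + r * (c n / c (Suc n)) * (T (Suc n) * ?tail (Suc n)) / r"
      using elim D0 T_pos[of n] c_pos[of n] by (intro add_right_mono mult_right_mono) auto
    finally show ?case .
  qed
qed

text \<open>The domain now shrinks with \<open>n\<close> while \<open>T / c ^ 3\<close> grows, so
  scale \<open>n\<close> is controlled by scale \<open>Suc n\<close>, with factor tending to
  \<open>sqrt r\<close>, plus a shell on which the integrand is at most \<open>c n ^ 3\<close>. The
  variance bound gives the a priori bound that a backward recursion needs, as one factor
  \<open>norm y\<close> is at most \<open>c n\<close>.\<close>

lemma third_moments_summable:
  assumes z: "norm z \<le> 1"
    and bnd: "\<forall>\<^sub>F n in sequentially. T n * (\<integral>y. indicator {y. norm y \<le> c n} y * (y \<bullet> z)\<^sup>2 \<partial>Pm) / (c n)\<^sup>2 \<le> K"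
  shows "summable (\<lambda>n. T n * (\<integral>y. indicator {y. norm y \<le> c n} y * (norm y * (y \<bullet> z)\<^sup>2) \<partial>Pm) / c n ^ 3)"
    (is "summable (\<lambda>n. T n * ?W n / c n ^ 3)")
proof (rule backward_recursion_summable[OF q(1,2)])
  let ?tail = "\<lambda>n. measure Pm {y. norm y > c n}"
  show "0 \<le> T n * ?W n / c n ^ 3" for n
    using c_pos[of n] T_pos[of n] by (simp add: Bochner_Integration.integral_nonneg)
  show "0 \<le> T (Suc n) * ?tail (Suc n) / r" for n using T_pos[of "Suc n"] r by simp
  have "summable (\<lambda>n. T (Suc n) * ?tail (Suc n))" using tails by (subst summable_Suc_iff)
  then show "summable (\<lambda>n. T (Suc n) * ?tail (Suc n) / r)" by (rule summable_divide)
  have c1: "\<forall>\<^sub>F n in sequentially. c n < 1" using c_tendsto_0 by (rule order_tendstoD) simp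
  from bnd c1 show "\<forall>\<^sub>F n in sequentially. T n * ?W n / c n ^ 3 \<le> K"
  proof eventually_elim
    case (elim n)
    note i = levy_truncated_integrable[OF lm less_imp_le[OF elim(2)], of z]
    have "?W n \<le> (\<integral>y. c n * (indicator {y. norm y \<le> c n} y * (y \<bullet> z)\<^sup>2) \<partial>Pm)"
      by (rule integral_mono) (use i c_pos in \<open>auto simp: indicator_def intro: mult_right_mono\<close>)
    then have "T n * ?W n / c n ^ 3 \<le> T n * (c n * (\<integral>y. indicator {y. norm y \<le> c n} y * (y \<bullet> z)\<^sup>2 \<partial>Pm)) / c n ^ 3"
      using T_pos[of n] c_pos[of n] by (intro divide_right_mono mult_left_mono) auto
    also have "\<dots> = T n * (\<integral>y. indicator {y. norm y \<le> c n} y * (y \<bullet> z)\<^sup>2 \<partial>Pm) / (c n)\<^sup>2"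
      using c_pos[of n] by (simp add: power2_eq_square power3_eq_cube)
    finally show ?case using elim(1) by linarith
  qed
  have "(\<lambda>n. (c (Suc n) / c n) ^ 3 / r) \<longlonglongrightarrow> sqrt r ^ 3 / r"
    using r by (intro tendsto_intros c_ratio) auto
  then have "\<forall>\<^sub>F n in sequentially. (c (Suc n) / c n) ^ 3 / r < q"
    using q(3) unfolding sqrt_r by (rule order_tendstoD)
  with c1 show "\<forall>\<^sub>F n in sequentially. T n * ?W n / c n ^ 3
      \<le> q * (T (Suc n) * ?W (Suc n) / c (Suc n) ^ 3) + T (Suc n) * ?tail (Suc n) / r"
  proof eventually_elim
    case (elim n)
    have c1: "c n \<le> 1" "c (Suc n) \<le> 1" using elim(1) c_Suc[of n] by auto
    note i = levy_truncated_integrable(2)[OF lm c1(1), of z] levy_truncated_integrable(2)[OF lm c1(2), of z]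
      jumps_integrable[OF c_pos[of "Suc n"]]
    have W0: "0 \<le> ?W (Suc n)" by (intro Bochner_Integration.integral_nonneg) simp
    have cube: "norm y * (y \<bullet> z)\<^sup>2 \<le> c n ^ 3" if "norm y \<le> c n" for y :: "real ^ 'd"
    proof -
      have "\<bar>y \<bullet> z\<bar> \<le> norm y"
        using Cauchy_Schwarz_ineq2[of y z] z mult_left_mono[of "norm z" 1 "norm y"] by simp
      then have "\<bar>y \<bullet> z\<bar>\<^sup>2 \<le> (c n)\<^sup>2" using that by (intro power_mono) auto
      then have "norm y * (y \<bullet> z)\<^sup>2 \<le> c n * (c n)\<^sup>2" using that c_pos[of n] by (intro mult_mono) auto
      then show ?thesis by (simp add: power2_eq_square power3_eq_cube)
    qed
    have "?W n \<le> (\<integral>y. indicator {y. norm y \<le> c (Suc n)} y * (norm y * (y \<bullet> z)\<^sup>2)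
        + c n ^ 3 * indicator {y. norm y > c (Suc n)} y \<partial>Pm)"
    proof (rule integral_mono)
      show "indicator {y. norm y \<le> c n} y * (norm y * (y \<bullet> z)\<^sup>2)
         \<le> indicator {y. norm y \<le> c (Suc n)} y * (norm y * (y \<bullet> z)\<^sup>2) + c n ^ 3 * indicator {y. norm y > c (Suc n)} y"
        for y :: "real ^ 'd"
        using cube[of y] c_pos[of n] by (auto simp: indicator_def)
    qed (use i in auto)
    also have "\<dots> = ?W (Suc n) + c n ^ 3 * ?tail (Suc n)"
      using i by (subst Bochner_Integration.integral_add) (auto simp: space_Pm)
    finally have "T n * ?W n / c n ^ 3 \<le> T n * (?W (Suc n) + c n ^ 3 * ?tail (Suc n)) / c n ^ 3"
      using T_pos[of n] c_pos[of n] by (intro divide_right_mono mult_left_mono) auto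
    also have "\<dots> = (c (Suc n) / c n) ^ 3 / r * (T (Suc n) * ?W (Suc n) / c (Suc n) ^ 3) + T (Suc n) * ?tail (Suc n) / r"
      using c_pos[of n] c_pos[of "Suc n"] r by (simp add: T_Suc field_simps)
    also have "\<dots> \<le> q * (T (Suc n) * ?W (Suc n) / c (Suc n) ^ 3) + T (Suc n) * ?tail (Suc n) / r"
      using elim(2) W0 T_pos[of "Suc n"] c_pos[of "Suc n"] by (intro add_right_mono mult_right_mono) auto
    finally show ?case .
  qed
qed

end

text \<open>Convergence of \<open>p\<close> to 0 only needs \<open>L\<close> to diverge; summability
  in addition needs \<open>\<kappa>'\<close> large enough for the Gaussian term. They are kept apart
  because the maximal inequality uses a level at which the Gaussian term need not be summable. The
  gap between \<open>\<kappa>'\<close> and \<open>\<kappa>\<close> absorbs the drift.\<close>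

lemma (in levy_scales) projection_tail_probabilities:
  fixes X :: "real \<Rightarrow> 'a \<Rightarrow> real ^ 'd" and b L :: "nat \<Rightarrow> real"
  assumes levy: "purely_non_gaussian_levy M X \<gamma> Pm" and z: "norm z \<le> 1"
    and \<delta>: "0 < \<delta>" "4 * \<delta> \<le> \<kappa>'" and c: "\<And>n. c n = \<delta> * b n" and \<kappa>: "0 < \<kappa>'" "\<kappa>' < \<kappa>"
    and v: "0 < v" and L: "filterlim L at_top sequentially"
    and var: "\<forall>\<^sub>F n in sequentially.
      T n * (\<integral>y. indicator {y. norm y \<le> c n} y * (y \<bullet> z)\<^sup>2 \<partial>Pm) / (b n)\<^sup>2 \<le> v / L n"
  obtains p where "p \<longlonglongrightarrow> 0"
    "summable (\<lambda>n. exp (- (\<kappa>'\<^sup>2 / (2 * v) * L n))) \<longrightarrow> summable p"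
    "\<forall>\<^sub>F n in sequentially. \<forall>s. 0 \<le> s \<and> s \<le> T n \<longrightarrow>
       measure M {\<omega>\<in>space M. \<kappa> * b n < X s \<omega> \<bullet> z} \<le> p n"
proof -
  define I1 where "I1 n = (\<integral>y. indicator {y. c n < norm y \<and> norm y \<le> 1} y * norm y \<partial>Pm)" for n
  define I2 where "I2 n = (\<integral>y. indicator {y. norm y \<le> c n} y * (y \<bullet> z)\<^sup>2 \<partial>Pm)" for n
  define I3 where "I3 n = (\<integral>y. indicator {y. norm y \<le> c n} y * (norm y * (y \<bullet> z)\<^sup>2) \<partial>Pm)" for n
  define tl where "tl n = T n * measure Pm {y. norm y > c n}" for n
  define \<beta> where "\<beta> n = T n * I3 n / b n ^ 3" for n
  have bc: "b n = c n / \<delta>" for n using c \<delta> by simp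
  have b_pos: "0 < b n" for n using c_pos[of n] \<delta> by (simp add: bc)
  have L1: "\<forall>\<^sub>F n in sequentially. 1 \<le> L n" using L by (simp add: filterlim_at_top)
  have b3: "summable (\<lambda>n. T n * I3 n / c n ^ 3)"
    unfolding I3_def
  proof (rule third_moments_summable[OF z, where K="v / \<delta>\<^sup>2"])
    from var L1 show "\<forall>\<^sub>F n in sequentially.
      T n * (\<integral>y. indicator {y. norm y \<le> c n} y * (y \<bullet> z)\<^sup>2 \<partial>Pm) / (c n)\<^sup>2 \<le> v / \<delta>\<^sup>2"
    proof eventually_elim
      case (elim n)
      have "v / L n \<le> v" using elim(2) v by (simp add: divide_le_eq)
      with elim(1) have "T n * I2 n / (b n)\<^sup>2 \<le> v" by (simp add: I2_def)
      then have "T n * I2 n / (b n)\<^sup>2 / \<delta>\<^sup>2 \<le> v / \<delta>\<^sup>2" by (rule divide_right_mono) simp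
      then show ?case by (simp add: I2_def c power_mult_distrib mult.commute)
    qed
  qed
  have \<beta>eq: "\<beta> n = \<delta> ^ 3 * (T n * I3 n / c n ^ 3)" for n
    using \<delta> by (simp add: \<beta>_def c power_mult_distrib)
  have \<beta>s: "summable \<beta>" unfolding \<beta>eq using b3 by (rule summable_mult)
  have \<beta>0: "0 \<le> \<beta> n" for n
    using T_pos[of n] b_pos[of n] by (simp add: \<beta>_def I3_def Bochner_Integration.integral_nonneg)
  \<comment> \<open>The drift and the compensator of the medium jumps in units of
    \<open>b n\<close>; being null, they are eventually below
    \<open>\<kappa> - \<kappa>'\<close>.\<close>
  define \<zeta> where "\<zeta> n = T n * (norm \<gamma> + I1 n) / b n" for n
  have "(\<lambda>n. \<delta> * (norm \<gamma> * (T n / c n) + T n * I1 n / c n)) \<longlonglongrightarrow> \<delta> * (norm \<gamma> * 0 + 0)"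
    unfolding I1_def by (intro tendsto_intros T_over_c_tendsto_0 medium_jumps_tendsto_0)
  moreover have "\<zeta> n = \<delta> * (norm \<gamma> * (T n / c n) + T n * I1 n / c n)" for n
    using \<delta> c_pos[of n] by (simp add: \<zeta>_def bc field_simps)
  then have "\<zeta> = (\<lambda>n. \<delta> * (norm \<gamma> * (T n / c n) + T n * I1 n / c n))" by (rule ext)
  ultimately have "\<zeta> \<longlonglongrightarrow> 0" by (simp only: mult_zero_right add_0_right)
  then have \<zeta>: "\<forall>\<^sub>F n in sequentially. \<zeta> n < \<kappa> - \<kappa>'" using \<kappa> by (intro order_tendstoD(2)) auto
  define C where "C = exp (27 / \<delta> ^ 3)"
  define p where "p n = tl n + C * (exp (- (\<kappa>'\<^sup>2 / (2 * v) * L n)) + \<beta> n)" for n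
  have tls: "summable tl" unfolding tl_def by (rule tails)
  have ps: "summable (\<lambda>n. exp (- (\<kappa>'\<^sup>2 / (2 * v) * L n))) \<longrightarrow> summable p"
    unfolding p_def using tls \<beta>s by (intro impI summable_add summable_mult)
  have "filterlim (\<lambda>n. \<kappa>'\<^sup>2 / (2 * v) * L n) at_top sequentially"
    using v \<kappa> by (intro filterlim_tendsto_pos_mult_at_top[OF tendsto_const _ L]) auto
  then have "(\<lambda>n. exp (- (\<kappa>'\<^sup>2 / (2 * v) * L n))) \<longlonglongrightarrow> 0"
    by (intro filterlim_compose[OF exp_at_bot] filterlim_compose[OF filterlim_uminus_at_bot_at_top])
  then have "p \<longlonglongrightarrow> 0 + C * (0 + 0)"
    unfolding p_def by (intro tendsto_intros summable_LIMSEQ_zero[OF tls] summable_LIMSEQ_zero[OF \<beta>s])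
  then have p0: "p \<longlonglongrightarrow> 0" by simp
  have "\<forall>\<^sub>F n in sequentially. c n < 1" using c_tendsto_0 by (rule order_tendstoD) simp
  moreover have "\<forall>\<^sub>F n in sequentially. \<beta> n < 1"
    using summable_LIMSEQ_zero[OF \<beta>s] by (rule order_tendstoD) simp
  ultimately have ev: "\<forall>\<^sub>F n in sequentially. \<forall>s. 0 \<le> s \<and> s \<le> T n \<longrightarrow>
       measure M {\<omega>\<in>space M. \<kappa> * b n < X s \<omega> \<bullet> z} \<le> p n"
    using \<zeta> L1 var
  proof eventually_elim
    case (elim n)
    have g: "0 < v / L n" using v elim(4) by simp
    obtain w where w: "0 \<le> w" and
      wle: "exp (- (\<kappa>' * w) + w\<^sup>2 / 2 * (v / L n) + w ^ 3 * exp (\<delta> * w) * \<beta> n)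
        \<le> exp (27 / \<delta> ^ 3) * (exp (- (\<kappa>'\<^sup>2 / (2 * (v / L n)))) + \<beta> n)"
      by (rule chernoff_parameter[OF \<kappa>(1) \<delta> g \<beta>0 elim(2)])
    show ?case
    proof (intro allI impI, elim conjE)
      fix s assume s: "0 \<le> s" "s \<le> T n"
      \<comment> \<open>In units of \<open>1 / b n\<close> the exponent takes the form treated by
        \<open>chernoff_parameter\<close>, with \<open>g = v / L n\<close>. The choice of
        \<open>w\<close> does not depend on \<open>s\<close>, so the bound is uniform in
        \<open>s\<close>.\<close>
      define u where "u = w / b n"
      have u: "0 \<le> u" using w b_pos[of n] by (simp add: u_def)
      have "u * (T n * (norm \<gamma> + I1 n)) = w * \<zeta> n" by (simp add: u_def \<zeta>_def)
      also have "\<dots> \<le> w * (\<kappa> - \<kappa>')" using w elim(3) by (intro mult_left_mono) auto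
      finally have e1: "u * (T n * (norm \<gamma> + I1 n)) \<le> w * (\<kappa> - \<kappa>')" .
      have "u\<^sup>2 / 2 * (T n * I2 n) = w\<^sup>2 / 2 * (T n * I2 n / (b n)\<^sup>2)" by (simp add: u_def power_divide)
      also have "\<dots> \<le> w\<^sup>2 / 2 * (v / L n)" using elim(5) by (intro mult_left_mono) (auto simp: I2_def)
      finally have e2: "u\<^sup>2 / 2 * (T n * I2 n) \<le> w\<^sup>2 / 2 * (v / L n)" .
      have "u * c n = \<delta> * w" using b_pos[of n] by (simp add: u_def c)
      then have e3: "u ^ 3 * exp (u * c n) * (T n * I3 n) = w ^ 3 * exp (\<delta> * w) * \<beta> n"
        by (simp add: u_def \<beta>_def power_divide)
      have e4: "u * (\<kappa> * b n) = w * \<kappa>" using b_pos[of n] by (simp add: u_def)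
      have "measure M {\<omega>\<in>space M. \<kappa> * b n < X s \<omega> \<bullet> z}
        \<le> tl n + exp (- (u * (\<kappa> * b n)) + u * (T n * (norm \<gamma> + I1 n)) + u\<^sup>2 / 2 * (T n * I2 n)
            + u ^ 3 * exp (u * c n) * (T n * I3 n))"
        unfolding tl_def I1_def I2_def I3_def
        by (rule levy_projection_tail[OF levy s c_pos _ u z]) (use elim(1) in simp)
      also have "\<dots> \<le> tl n + exp (- (\<kappa>' * w) + w\<^sup>2 / 2 * (v / L n) + w ^ 3 * exp (\<delta> * w) * \<beta> n)"
      proof -
        have "u * (T n * (norm \<gamma> + I1 n)) \<le> w * \<kappa> - \<kappa>' * w" using e1 by (simp only: right_diff_distrib mult.commute)
        then have "- (w * \<kappa>) + u * (T n * (norm \<gamma> + I1 n)) + u\<^sup>2 / 2 * (T n * I2 n) + w ^ 3 * exp (\<delta> * w) * \<beta> n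
            \<le> - (\<kappa>' * w) + w\<^sup>2 / 2 * (v / L n) + w ^ 3 * exp (\<delta> * w) * \<beta> n"
          using e2 by linarith
        then show ?thesis unfolding e3 e4 by (simp only: add_le_cancel_left exp_le_cancel_iff)
      qed
      also have "\<dots> \<le> tl n + C * (exp (- (\<kappa>'\<^sup>2 / (2 * (v / L n)))) + \<beta> n)"
        unfolding C_def using wle by (rule add_left_mono)
      also have "\<dots> = p n" by (simp add: p_def)
      finally show "measure M {\<omega>\<in>space M. \<kappa> * b n < X s \<omega> \<bullet> z} \<le> p n" .
    qed
  qed
  show ?thesis by (rule that[OF p0 ps ev])
qed

subsection \<open>The norming function\<close>

text \<open>With \<open>x = ln (1 / t)\<close> and \<open>y = ln (1 / s)\<close> the claim is that
  \<open>exp (- y) * ln y \<le> exp (- x) * ln x\<close>. It follows from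
  \<open>ln y - ln x \<le> y - x \<le> ln x * (y - x)\<close>, where the last step needs
  \<open>ln x \<ge> 1\<close>; this is the condition \<open>t \<le> exp (- exp 1)\<close>.\<close>

lemma iterated_log_mono:
  fixes s t :: real
  assumes s: "0 < s" "s \<le> t" and t: "t \<le> exp (- exp 1)"
  shows "s * ln (ln (1 / s)) \<le> t * ln (ln (1 / t))"
proof -
  define x y where "x = ln (1 / t)" and "y = ln (1 / s)"
  have t0: "0 < t" using s by simp
  have "ln t \<le> - exp 1" using t t0 by (metis ln_exp ln_le_cancel_iff exp_gt_zero)
  then have x: "exp 1 \<le> x" using t0 by (simp add: x_def ln_div)
  have xy: "x \<le> y" unfolding x_def y_def using s by (simp add: frac_le)
  have x1: "1 \<le> x" using x exp_ge_add_one_self[of 1] by linarith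
  have lx: "1 \<le> ln x" using x x1 by (metis ln_exp ln_mono exp_gt_zero)
  have "ln y - ln x = ln (y / x)" using x1 xy by (simp add: ln_div)
  also have "\<dots> \<le> y / x - 1" using x1 xy by (intro ln_le_minus_one) auto
  also have "\<dots> = (y - x) / x" using x1 by (simp add: field_simps)
  also have "\<dots> \<le> y - x" using x1 xy by (simp add: divide_le_eq mult_le_cancel_left1)
  also have "\<dots> \<le> ln x * (y - x)" using lx xy mult_right_mono[of 1 "ln x" "y - x"] by simp
  finally have "ln y \<le> ln x * (1 + (y - x))" by (simp add: algebra_simps)
  also have "\<dots> \<le> ln x * exp (y - x)" using lx exp_ge_add_one_self by (intro mult_left_mono) auto
  finally have "exp (- y) * ln y \<le> exp (- y) * (ln x * exp (y - x))" by (intro mult_left_mono) auto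
  also have "\<dots> = exp (- x) * ln x" by (simp add: exp_diff exp_minus field_simps)
  finally show ?thesis using s t0 by (simp add: x_def y_def ln_div)
qed

lemma norming_mono:
  fixes h :: "real \<Rightarrow> real"
  assumes h: "mono_on {0..} h" and pos: "0 < h (1 / t)"
    and s: "0 < s" "s \<le> t" and t: "t \<le> exp (- exp 1)"
  shows "sqrt (s * ln (ln (1 / s))) / h (1 / s) \<le> sqrt (t * ln (ln (1 / t))) / h (1 / t)"
proof (rule frac_le)
  have "1 / t \<le> 1 / s" using s by (simp add: frac_le)
  then show "h (1 / t) \<le> h (1 / s)" using s by (intro mono_onD[OF h]) auto
  show "sqrt (s * ln (ln (1 / s))) \<le> sqrt (t * ln (ln (1 / t)))"
    using iterated_log_mono[OF s t] by simp
  have "exp 1 \<le> ln (1 / t)"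
  proof -
    have "ln t \<le> - exp 1" using t s by (metis ln_exp ln_le_cancel_iff exp_gt_zero order_less_le_trans)
    then show ?thesis using s by (simp add: ln_div)
  qed
  then have "1 \<le> ln (1 / t)" using exp_ge_add_one_self[of "1::real"] by linarith
  then show "0 \<le> sqrt (t * ln (ln (1 / t)))" using s by simp
qed (rule pos)

text \<open>The iterated logarithm and \<open>h\<close> both vary slowly, the latter used at
  \<open>1 / t\<close> with multiplier \<open>1 / r\<close>, so only the factor
  \<open>sqrt t\<close> leaves a trace in the limit.\<close>

lemma norming_ratio:
  fixes h :: "real \<Rightarrow> real"
  assumes slow: "\<And>c. 0 < c \<Longrightarrow> ((\<lambda>x. h (c * x) / h x) \<longlongrightarrow> 1) at_top" and r: "0 < r"
  shows "((\<lambda>t. (sqrt (r * t * ln (ln (1 / (r * t)))) / h (1 / (r * t))) / (sqrt (t * ln (ln (1 / t))) / h (1 / t)))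
    \<longlongrightarrow> sqrt r) (at_right 0)"
proof -
  have "((\<lambda>t. ln (ln (1 / (r * t))) / ln (ln (1 / t))) \<longlongrightarrow> 1) (at_right 0)"
    using r by real_asymp
  then have l1: "((\<lambda>t. sqrt (ln (ln (1 / (r * t))) / ln (ln (1 / t)))) \<longlongrightarrow> sqrt 1) (at_right 0)"
    by (rule tendsto_real_sqrt)
  have l2: "((\<lambda>t. h (1 / r * (1 / t)) / h (1 / t)) \<longlongrightarrow> 1) (at_right 0)"
    using r by (intro filterlim_compose[OF slow]) (auto simp: inverse_eq_divide[symmetric] filterlim_inverse_at_top_right)
  have "((\<lambda>t. sqrt r * sqrt (ln (ln (1 / (r * t))) / ln (ln (1 / t))) / (h (1 / r * (1 / t)) / h (1 / t)))
      \<longlongrightarrow> sqrt r * sqrt 1 / 1) (at_right 0)"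
    by (intro tendsto_divide[OF tendsto_mult[OF tendsto_const l1] l2]) simp
  moreover have "\<forall>\<^sub>F t in at_right 0. sqrt r * sqrt (ln (ln (1 / (r * t))) / ln (ln (1 / t))) / (h (1 / r * (1 / t)) / h (1 / t))
     = (sqrt (r * t * ln (ln (1 / (r * t)))) / h (1 / (r * t))) / (sqrt (t * ln (ln (1 / t))) / h (1 / t))"
    using eventually_at_right_less[of 0]
    by eventually_elim (simp add: real_sqrt_mult real_sqrt_divide mult_ac)
  ultimately show ?thesis by (simp add: tendsto_cong)
qed

text \<open>For \<open>t\<close> between \<open>T (Suc n)\<close> and \<open>T n\<close>
  monotonicity gives \<open>b t \<le> b (T n)\<close>, so the integrand is at least its value at
  \<open>T n\<close>. The interval has length \<open>(1 - r) * T n\<close>, and the intervals are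
  disjoint, so the integral dominates \<open>1 - r\<close> times the series.\<close>

lemma geometric_tails_summable:
  fixes Pm :: "(real ^ 'd) measure" and b :: "real \<Rightarrow> real"
  assumes lm: "levy_measure Pm" and r: "0 < r" "r < 1" and t1: "0 < t1"
    and b_pos: "\<And>t. 0 < t \<Longrightarrow> t \<le> t1 \<Longrightarrow> 0 < b t"
    and b_mono: "\<And>s t. 0 < s \<Longrightarrow> s \<le> t \<Longrightarrow> t \<le> t1 \<Longrightarrow> b s \<le> b t"
    and fin: "(\<integral>\<^sup>+ t\<in>{0<..t1}. Pibar Pm (b t) \<partial>lborel) < \<infinity>"
  shows "summable (\<lambda>n. t1 * r ^ n * measure Pm {y. norm y > b (t1 * r ^ n)})"
proof -
  have s[measurable_cong]: "sets Pm = sets borel" using lm by (simp add: levy_measure_def)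
  define T where "T n = t1 * r ^ n" for n
  have T_pos: "0 < T n" for n using r t1 by (simp add: T_def)
  have T_dec: "T n \<le> T m" if "m \<le> n" for m n
    using that r t1 unfolding T_def by (intro mult_left_mono power_decreasing) auto
  have T_le: "T n \<le> t1" for n using T_dec[of 0 n] by (simp add: T_def)
  define a where "a n = measure Pm {y. norm y > b (T n)}" for n
  have Pa: "Pibar Pm (b (T n)) = ennreal (a n)" for n
    unfolding Pibar_def a_def using levy_measure_tail_finite[OF lm b_pos[OF T_pos T_le]]
    by (intro emeasure_eq_ennreal_measure) (auto simp: less_top)
  define F where "F = (\<integral>\<^sup>+ t\<in>{0<..t1}. Pibar Pm (b t) \<partial>lborel)"
  have unique: "m = n" if "t \<in> {T (Suc m)<..T m}" "t \<in> {T (Suc n)<..T n}" for m n t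
  proof (rule ccontr)
    assume "m \<noteq> n"
    then consider "Suc m \<le> n" | "Suc n \<le> m" by linarith
    then show False using that T_dec[of "Suc m" n] T_dec[of "Suc n" m] by cases auto
  qed
  have pw: "(\<Sum>n<N. ennreal (a n) * indicator {T (Suc n)<..T n} t) \<le> Pibar Pm (b t) * indicator {0<..t1} t" for N t
  proof (cases "\<exists>m<N. t \<in> {T (Suc m)<..T m}")
    case True
    then obtain m where m: "m < N" "t \<in> {T (Suc m)<..T m}" by blast
    have "(\<Sum>n<N. ennreal (a n) * indicator {T (Suc n)<..T n} t) = (\<Sum>n<N. if n = m then ennreal (a m) else 0)"
      using m(2) unique by (intro sum.cong) (auto simp: indicator_def)
    also have "\<dots> = Pibar Pm (b (T m))" using m(1) by (simp add: Pa)
    also have "\<dots> \<le> Pibar Pm (b t)"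
    proof -
      have "b t \<le> b (T m)" using m T_pos[of "Suc m"] T_le[of m] by (intro b_mono) auto
      then show ?thesis unfolding Pibar_def by (intro emeasure_mono) auto
    qed
    also have "\<dots> = Pibar Pm (b t) * indicator {0<..t1} t"
      using m T_pos[of "Suc m"] T_le[of m] by simp
    finally show ?thesis .
  next
    case False
    then have "(\<Sum>n<N. ennreal (a n) * indicator {T (Suc n)<..T n} t) = 0"
      by (auto simp: indicator_def)
    then show ?thesis by simp
  qed
  have "summable (\<lambda>n. (T n - T (Suc n)) * a n)"
  proof (rule summableI_nonneg_bounded)
    have an: "0 \<le> (T n - T (Suc n)) * a n" for n
      using T_dec[of n "Suc n"] by (simp add: a_def)
    then show "0 \<le> (T n - T (Suc n)) * a n" for n .
    fix N
    have "ennreal (\<Sum>n<N. (T n - T (Suc n)) * a n) = (\<Sum>n<N. ennreal ((T n - T (Suc n)) * a n))"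
      using an by (simp add: sum_ennreal)
    also have "\<dots> = (\<Sum>n<N. \<integral>\<^sup>+t. ennreal (a n) * indicator {T (Suc n)<..T n} t \<partial>lborel)"
    proof (rule sum.cong[OF refl])
      fix n
      have "(\<integral>\<^sup>+t. ennreal (a n) * indicator {T (Suc n)<..T n} t \<partial>lborel) = ennreal (a n) * ennreal (T n - T (Suc n))"
        using T_dec[of n "Suc n"] by (subst nn_integral_cmult_indicator) auto
      also have "\<dots> = ennreal ((T n - T (Suc n)) * a n)"
        by (subst ennreal_mult'[symmetric]) (auto simp: a_def mult.commute)
      finally show "ennreal ((T n - T (Suc n)) * a n) = (\<integral>\<^sup>+t. ennreal (a n) * indicator {T (Suc n)<..T n} t \<partial>lborel)" ..
    qed
    also have "\<dots> = (\<integral>\<^sup>+t. (\<Sum>n<N. ennreal (a n) * indicator {T (Suc n)<..T n} t) \<partial>lborel)"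
      by (rule nn_integral_sum[symmetric]) simp
    also have "\<dots> \<le> F" unfolding F_def by (rule nn_integral_mono) (rule pw)
    finally have "ennreal (\<Sum>n<N. (T n - T (Suc n)) * a n) \<le> F" .
    moreover have "F < top" using fin by (simp add: F_def)
    ultimately have "ennreal (\<Sum>n<N. (T n - T (Suc n)) * a n) \<le> ennreal (enn2real F)" by simp
    then show "(\<Sum>n<N. (T n - T (Suc n)) * a n) \<le> enn2real F"
      by (subst (asm) ennreal_le_iff) auto
  qed
  then have "summable (\<lambda>n. (T n - T (Suc n)) * a n / (1 - r))" by (rule summable_divide)
  moreover have "(\<lambda>n. (T n - T (Suc n)) * a n / (1 - r)) = (\<lambda>n. T n * a n)"
    using r by (intro ext) (simp add: T_def field_simps)
  ultimately show ?thesis unfolding T_def a_def by (simp only:)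
qed

lemma finite_sphere_net:
  assumes \<theta>: "1 < \<theta>"
  obtains Z :: "('v::euclidean_space) set" where "finite Z" "\<And>z. z \<in> Z \<Longrightarrow> norm z = 1"
    "\<And>x B. 0 \<le> B \<Longrightarrow> (\<And>z. z \<in> Z \<Longrightarrow> x \<bullet> z \<le> B) \<Longrightarrow> norm x \<le> \<theta> * B"
proof -
  \<comment> \<open>If \<open>norm (u - z) < e\<close> for unit \<open>u\<close>, then
    \<open>u \<bullet> z \<ge> 1 - e\<close>, and this mesh makes the lower bound exactly
    \<open>1 / \<theta>\<close>.\<close>
  define e where "e = 1 - 1 / \<theta>"
  have e: "0 < e" using \<theta> by (simp add: e_def)
  obtain Z where Z: "finite Z" "Z \<subseteq> sphere 0 1" "sphere (0::'v) 1 \<subseteq> (\<Union>z\<in>Z. ball z e)"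
    using compactE_image[OF compact_sphere, of "sphere (0::'v) 1" "\<lambda>z. ball z e" 0 1] e
    by (metis UN_I centre_in_ball open_ball subsetI)
  show ?thesis
  proof (rule that[OF Z(1)])
    show "norm z = 1" if "z \<in> Z" for z using that Z(2) by auto
    fix x :: 'v and B :: real assume B: "0 \<le> B" "\<And>z. z \<in> Z \<Longrightarrow> x \<bullet> z \<le> B"
    show "norm x \<le> \<theta> * B"
    proof (cases "x = 0")
      case True then show ?thesis using B(1) \<theta> by simp
    next
      case False
      define u where "u = x /\<^sub>R norm x"
      have u: "norm u = 1" using False by (simp add: u_def)
      then have "u \<in> sphere 0 1" by simp
      then have "u \<in> (\<Union>z\<in>Z. ball z e)" using Z(3) by blast
      then obtain z where z: "z \<in> Z" "norm (u - z) < e" by (auto simp: dist_norm norm_minus_commute)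
      have "u \<bullet> z = u \<bullet> u - u \<bullet> (u - z)" by (simp add: inner_diff_right)
      also have "u \<bullet> u = 1" using u by (simp add: norm_eq_1)
      finally have "1 - e \<le> u \<bullet> z" using norm_cauchy_schwarz[of u "u - z"] u z(2) by simp
      then have "norm x * (1 / \<theta>) \<le> norm x * (u \<bullet> z)" by (intro mult_left_mono) (auto simp: e_def)
      also have "\<dots> = x \<bullet> z" using False by (simp add: u_def)
      also have "\<dots> \<le> B" by (rule B(2)[OF z(1)])
      finally show ?thesis using \<theta> by (simp add: field_simps)
    qed
  qed
qed

subsection \<open>Proof of the theorem\<close>

locale small_time_lil =
  fixes M :: "'a measure" and X :: "real \<Rightarrow> 'a \<Rightarrow> real ^ 'd"
    and \<gamma> :: "real ^ 'd" and Pm :: "(real ^ 'd) measure"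
    and h :: "real \<Rightarrow> real" and b :: "real \<Rightarrow> real" and t0 :: real and lam :: real
  assumes levy: "purely_non_gaussian_levy M X \<gamma> Pm"
    and hH1: "H1 h"
    and t0: "0 < t0" "t0 < exp (-1)"
    and b_def: "\<And>t. 0 < t \<Longrightarrow> t \<le> t0 \<Longrightarrow> b t = sqrt (t * ln (ln (1 / t))) / h (1 / t)"
    and b_pos: "\<And>t. 0 < t \<Longrightarrow> t \<le> t0 \<Longrightarrow> b t > 0"
    and int_fin: "(\<integral>\<^sup>+ t\<in>{0<..t0}. Pibar Pm (b t) \<partial>lborel) < \<infinity>"
    and lam_nonneg: "lam \<ge> 0"
    and V_cond: "Limsup (at_right 0) (\<lambda>t. ereal (Vfun Pm (b t) * (h (1 / t))\<^sup>2)) \<le> ereal (lam\<^sup>2 / 2)"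
begin

lemma lm: "levy_measure Pm" using levy by (simp add: purely_non_gaussian_levy_def)

sublocale prob_space M using levy by (simp add: purely_non_gaussian_levy_def)

lemma iterated_log_pos:
  assumes "0 < t" "t \<le> t0" shows "0 < ln (ln (1 / t))"
proof -
  have "ln t < - 1" using assms t0 by (metis ln_exp ln_less_cancel_iff exp_gt_zero order_le_less_trans)
  then have "1 < ln (1 / t)" using assms by (simp add: ln_div)
  then show ?thesis by simp
qed

lemma h_pos:
  assumes "0 < t" "t \<le> t0" shows "0 < h (1 / t)"
proof -
  have "0 \<le> h (1 / t)" using hH1 assms by (simp add: H1_def)
  \<comment> \<open>If \<open>h (1 / t)\<close> were 0, division by zero would give
    \<open>b t = 0\<close>, against \<open>b_pos\<close>.\<close>
  moreover have "h (1 / t) \<noteq> 0" using b_pos[OF assms] b_def[OF assms] by auto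
  ultimately show ?thesis by simp
qed

text \<open>Below \<open>exp (- exp 1)\<close> the function \<open>t * ln (ln (1 / t))\<close> is
  increasing, and with it \<open>b\<close>.\<close>

definition t1 where "t1 = min t0 (exp (- exp 1))"

lemma t1: "0 < t1" "t1 \<le> t0" "t1 \<le> exp (- exp 1)" using t0 by (auto simp: t1_def)

lemma b_mono: "0 < s \<Longrightarrow> s \<le> t \<Longrightarrow> t \<le> t1 \<Longrightarrow> b s \<le> b t"
  using norming_mono[of h t s] hH1 h_pos[of t] t1 b_def[of s] b_def[of t] by (simp add: H1_def)

lemma b_ratio:
  assumes r: "0 < r" "r < 1"
  shows "((\<lambda>t. b (r * t) / b t) \<longlongrightarrow> sqrt r) (at_right 0)"
proof -
  have "\<forall>\<^sub>F t in at_right 0. t < t0" using t0 by (simp add: eventually_at_right_field) blast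
  then have "\<forall>\<^sub>F t in at_right 0. (sqrt (r * t * ln (ln (1 / (r * t)))) / h (1 / (r * t))) / (sqrt (t * ln (ln (1 / t))) / h (1 / t))
      = b (r * t) / b t"
    using eventually_at_right_less[of 0]
  proof eventually_elim
    case (elim t)
    have "r * t \<le> 1 * t" using r elim by (intro mult_right_mono) auto
    then have "r * t \<le> t0" using elim by linarith
    moreover have "0 < r * t" using r elim by simp
    ultimately have "b (r * t) = sqrt (r * t * ln (ln (1 / (r * t)))) / h (1 / (r * t))"
      and "b t = sqrt (t * ln (ln (1 / t))) / h (1 / t)"
      using elim r by (auto intro!: b_def)
    then show ?case by (simp only:)
  qed
  then show ?thesis
    using norming_ratio[of h r] hH1 r by (simp add: H1_def tendsto_cong)
qed

section \<open>Norming values and jump tails along geometric times\<close>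

context
  fixes r :: real
  assumes r: "0 < r" "r < 1"
begin

definition T where "T n = t1 * r ^ n"

lemma T: "0 < T n" "T n \<le> t1" "T (Suc n) = r * T n" "T (Suc n) \<le> T n"
proof -
  show "0 < T n" for n using t1 r by (simp add: T_def)
  show s: "T (Suc n) = r * T n" by (simp add: T_def)
  have "r ^ n \<le> 1" using r by (simp add: power_le_one)
  then show "T n \<le> t1" using t1 by (simp add: T_def)
  show "T (Suc n) \<le> T n" unfolding T_def using t1 r by (simp add: mult_le_cancel_right1)
qed

lemma b_T_pos: "0 < b (T n)" using b_pos T t1 by (meson order_trans)

lemma T_tendsto: "filterlim T (at_right 0) sequentially"
proof -
  have "(\<lambda>n. t1 * r ^ n) \<longlonglongrightarrow> t1 * 0" using r by (intro tendsto_intros) auto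
  then have "T \<longlonglongrightarrow> 0" by (simp add: T_def[abs_def])
  moreover have "T n \<in> {0<..} \<and> T n \<noteq> 0" for n using T(1)[of n] by simp
  ultimately show ?thesis unfolding filterlim_at by simp
qed

lemma b_T_ratio: "(\<lambda>n. b (T (Suc n)) / b (T n)) \<longlonglongrightarrow> sqrt r"
  unfolding T(3) by (rule filterlim_compose[OF b_ratio[OF r] T_tendsto])

lemma b_T_ratio_power: "(\<lambda>n. b (T (n + k)) / b (T n)) \<longlonglongrightarrow> sqrt r ^ k"
proof (induction k)
  case 0
  then show ?case using b_T_pos by (simp add: less_imp_neq[symmetric])
next
  case (Suc k)
  have "(\<lambda>n. b (T (Suc (n + k))) / b (T (n + k)) * (b (T (n + k)) / b (T n))) \<longlonglongrightarrow> sqrt r * sqrt r ^ k"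
    using LIMSEQ_ignore_initial_segment[OF b_T_ratio, of k] Suc by (rule tendsto_mult)
  moreover have "b (T (Suc (n + k))) / b (T (n + k)) * (b (T (n + k)) / b (T n)) = b (T (n + Suc k)) / b (T n)" for n
    using b_T_pos[of "n + k"] by simp
  ultimately show ?case by (simp only: power_Suc)
qed

lemma tails_summable: "summable (\<lambda>n. T n * measure Pm {y. norm y > b (T n)})"
  unfolding T_def
proof (rule geometric_tails_summable[OF lm r t1(1) _ b_mono])
  show "0 < b t" if "0 < t" "t \<le> t1" for t using that t1 by (intro b_pos) auto
  have "(\<integral>\<^sup>+ t\<in>{0<..t1}. Pibar Pm (b t) \<partial>lborel) \<le> (\<integral>\<^sup>+ t\<in>{0<..t0}. Pibar Pm (b t) \<partial>lborel)"
    by (rule nn_integral_mono) (use t1 in \<open>auto simp: indicator_def\<close>)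
  then show "(\<integral>\<^sup>+ t\<in>{0<..t1}. Pibar Pm (b t) \<partial>lborel) < \<infinity>" using int_fin by (rule le_less_trans)
qed auto

text \<open>By regular variation, shifting the index by a fixed \<open>k\<close> multiplies
  \<open>b (T n)\<close> asymptotically by \<open>sqrt r ^ k\<close>, which falls below
  \<open>\<delta>\<close> for suitable \<open>k\<close>. The tail at
  \<open>\<delta> * b (T n)\<close> is then bounded by the tail \<open>k\<close> scales later, at
  the cost of the constant \<open>1 / r ^ k\<close>.\<close>

lemma scaled_tails_summable:
  assumes \<delta>: "0 < \<delta>"
  shows "summable (\<lambda>n. T n * measure Pm {y. norm y > \<delta> * b (T n)})"
proof -
  have s: "sets Pm = sets borel" using lm by (simp add: levy_measure_def)
  have "(\<lambda>k. sqrt r ^ k) \<longlonglongrightarrow> 0" using r by (intro LIMSEQ_power_zero) auto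
  then have "\<forall>\<^sub>F k in sequentially. sqrt r ^ k < \<delta>" using \<delta> by (rule order_tendstoD)
  then obtain k where k: "sqrt r ^ k < \<delta>" by (auto simp: eventually_sequentially)
  have "\<forall>\<^sub>F n in sequentially. b (T (n + k)) / b (T n) < \<delta>"
    using b_T_ratio_power k by (rule order_tendstoD)
  then have "\<forall>\<^sub>F n in sequentially. norm (T n * measure Pm {y. norm y > \<delta> * b (T n)})
      \<le> T (n + k) * measure Pm {y. norm y > b (T (n + k))} / r ^ k"
  proof eventually_elim
    case (elim n)
    have "b (T (n + k)) \<le> \<delta> * b (T n)" using elim b_T_pos[of n] by (simp add: divide_less_eq)
    then have "measure Pm {y. norm y > \<delta> * b (T n)} \<le> measure Pm {y. norm y > b (T (n + k))}"
      using levy_measure_tail_finite[OF lm b_T_pos[of "n + k"]]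
      by (intro measure_mono_fmeasurable) (auto simp: s fmeasurable_def)
    then have "T n * measure Pm {y. norm y > \<delta> * b (T n)} \<le> T n * measure Pm {y. norm y > b (T (n + k))}"
      using T(1)[of n] by simp
    also have "\<dots> = T (n + k) * measure Pm {y. norm y > b (T (n + k))} / r ^ k"
      using r by (simp add: T_def power_add)
    finally show ?case using T(1)[of n] by simp
  qed
  moreover have "summable (\<lambda>n. T (n + k) * measure Pm {y. norm y > b (T (n + k))} / r ^ k)"
    using summable_ignore_initial_segment[OF tails_summable, of k] by (rule summable_divide)
  ultimately show ?thesis by (rule summable_comparison_test_ev)
qed

lemma scales:
  assumes \<delta>: "0 < \<delta>"
  shows "levy_scales Pm r T (\<lambda>n. \<delta> * b (T n))"
proof
  show "(\<lambda>n. \<delta> * b (T (Suc n)) / (\<delta> * b (T n))) \<longlonglongrightarrow> sqrt r"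
    using b_T_ratio \<delta> by simp
  show "\<delta> * b (T (Suc n)) \<le> \<delta> * b (T n)" for n
    using b_mono[OF T(1) T(4) T(2)] \<delta> by simp
qed (use lm r T b_T_pos \<delta> scaled_tails_summable[OF \<delta>] in auto)

text \<open>The exponential is the power \<open>- a\<close> of \<open>ln (1 / T n)\<close>, which is
  at least \<open>n * ln (1 / r)\<close> because \<open>t1 < 1\<close>; the series is thus dominated
  by a convergent p-series.\<close>

lemma iterated_log_T:
  "filterlim (\<lambda>n. ln (ln (1 / T n))) at_top sequentially"
  "1 < a \<Longrightarrow> summable (\<lambda>n. exp (- (a * ln (ln (1 / T n)))))"
proof -
  have "filterlim (\<lambda>t::real. ln (ln (1 / t))) at_top (at_right 0)" by real_asymp
  then show "filterlim (\<lambda>n. ln (ln (1 / T n))) at_top sequentially"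
    using T_tendsto by (rule filterlim_compose)
  assume a: "1 < a"
  have sm: "summable (\<lambda>n. ln (1 / r) powr (- a) * real n powr (- a))"
    using a by (intro summable_mult) (simp add: summable_real_powr_iff)
  have le: "norm (exp (- (a * ln (ln (1 / T n))))) \<le> ln (1 / r) powr (- a) * real n powr (- a)"
    if n: "n \<ge> 1" for n
  proof -
    have lr: "0 < ln (1 / r)" using r by simp
    have "t1 < 1" using t1 t0 by (smt (verit) exp_less_one_iff)
    then have "ln t1 < 0" using t1 by simp
    moreover have "ln (T n) = ln t1 + n * ln r" using t1 r by (simp add: T_def ln_mult ln_realpow)
    ultimately have le: "n * ln (1 / r) \<le> ln (1 / T n)" using T(1)[of n] r by (simp add: ln_div)
    have pos: "0 < n * ln (1 / r)" using n lr by simp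
    have "exp (- (a * ln (ln (1 / T n)))) = ln (1 / T n) powr (- a)"
      using pos le by (simp add: powr_def)
    also have "\<dots> \<le> (n * ln (1 / r)) powr (- a)"
      using a pos le by (intro powr_mono2') auto
    also have "\<dots> = ln (1 / r) powr (- a) * real n powr (- a)"
      using lr by (simp add: powr_mult mult.commute)
    finally show ?thesis by simp
  qed
  show "summable (\<lambda>n. exp (- (a * ln (ln (1 / T n)))))"
    by (rule summable_comparison_test[OF _ sm]) (use le in blast)
qed

end

section \<open>From the hypothesis on \<open>V\<close> to tail probabilities and almost sure
  bounds\<close>

lemma truncated_variance_le_Vfun:
  assumes z: "norm z \<le> 1" and c: "c \<le> x" and x: "x \<le> 1"
  shows "(\<integral>y. indicator {y. norm y \<le> c} y * (y \<bullet> z)\<^sup>2 \<partial>Pm) \<le> Vfun Pm x"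
proof -
  note i = levy_truncated_integrable(1)[OF lm x]
  \<comment> \<open>The truncated second moment bounds the family under the supremum; a real-valued
    \<open>SUP\<close> is an upper bound only once boundedness is known.\<close>
  have n: "integrable Pm (\<lambda>y. indicator {y. norm y \<le> x} y * (norm y)\<^sup>2)"
    by (rule levy_measure_integrable[OF lm, where C=1])
       (use x in \<open>auto simp: indicator_def power_le_one\<close>)
  have "(\<integral>y. indicator {y. norm y \<le> x} y * (y \<bullet> w)\<^sup>2 \<partial>Pm) \<le> (\<integral>y. indicator {y. norm y \<le> x} y * (norm y)\<^sup>2 \<partial>Pm)"
    if w: "w \<in> cball 0 1" for w
  proof (rule integral_mono[OF i n])
    fix y :: "real ^ 'd"
    have "\<bar>y \<bullet> w\<bar> \<le> norm y"
      using Cauchy_Schwarz_ineq2[of y w] w mult_left_mono[of "norm w" 1 "norm y"] by simp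
    then have "\<bar>y \<bullet> w\<bar>\<^sup>2 \<le> (norm y)\<^sup>2" by (intro power_mono) auto
    then show "indicator {y. norm y \<le> x} y * (y \<bullet> w)\<^sup>2 \<le> indicator {y. norm y \<le> x} y * (norm y)\<^sup>2"
      by (auto simp: indicator_def)
  qed
  then have bdd: "bdd_above ((\<lambda>w. \<integral>y. indicator {y. norm y \<le> x} y * (y \<bullet> w)\<^sup>2 \<partial>Pm) ` cball 0 1)"
    by (rule bdd_aboveI2)
  have "(\<integral>y. indicator {y. norm y \<le> c} y * (y \<bullet> z)\<^sup>2 \<partial>Pm) \<le> (\<integral>y. indicator {y. norm y \<le> x} y * (y \<bullet> z)\<^sup>2 \<partial>Pm)"
    by (rule integral_mono[OF levy_truncated_integrable(1)[OF lm order_trans[OF c x]] i])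
       (use c in \<open>auto simp: indicator_def\<close>)
  also have "\<dots> \<le> Vfun Pm x"
    unfolding Vfun_def using z by (intro cSUP_upper[OF _ bdd]) simp
  finally show ?thesis .
qed

text \<open>Since the square of \<open>b t\<close> is \<open>t * ln (ln (1 / t))\<close> over the
  square of \<open>h (1 / t)\<close>, the hypothesis on \<open>V\<close> says exactly that the
  normalised variance is eventually at most \<open>v / ln (ln (1 / t))\<close>. The Gaussian term
  becomes a power of \<open>ln (1 / T r n)\<close>, summable once its exponent exceeds 1.\<close>

lemma tail_probabilities:
  assumes r: "0 < r" "r < 1" and z: "norm z \<le> 1" and \<kappa>: "0 < \<kappa>'" "\<kappa>' < \<kappa>" and v: "lam\<^sup>2 / 2 < v"
  obtains p where "p \<longlonglongrightarrow> 0" "2 * v < \<kappa>'\<^sup>2 \<longrightarrow> summable p"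
    "\<forall>\<^sub>F n in sequentially. \<forall>s. 0 \<le> s \<and> s \<le> T r n \<longrightarrow> prob {\<omega>\<in>space M. \<kappa> * b (T r n) < X s \<omega> \<bullet> z} \<le> p n"
proof -
  have v0: "0 < v" using v by (smt (verit) divide_nonneg_pos zero_le_power2)
  \<comment> \<open>At most 1, so that the variance up to the cut is bounded by \<open>V\<close> at
    \<open>b\<close>; at most \<open>\<kappa>' / 4\<close> for
    \<open>chernoff_parameter\<close>.\<close>
  define \<delta> where "\<delta> = min 1 (\<kappa>' / 4)"
  have \<delta>: "0 < \<delta>" "4 * \<delta> \<le> \<kappa>'" "\<delta> \<le> 1" using \<kappa> by (auto simp: \<delta>_def)
  interpret levy_scales Pm r "T r" "\<lambda>n. \<delta> * b (T r n)" by (rule scales[OF r \<delta>(1)])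
  have "(\<lambda>n. \<delta> * b (T r n) / \<delta>) \<longlonglongrightarrow> 0 / \<delta>" using c_tendsto_0 \<delta> by (intro tendsto_divide) auto
  then have "(\<lambda>n. b (T r n)) \<longlonglongrightarrow> 0" using \<delta> by simp
  then have b1: "\<forall>\<^sub>F n in sequentially. b (T r n) < 1" by (rule order_tendstoD) simp
  have "\<forall>\<^sub>F t in at_right 0. ereal (Vfun Pm (b t) * (h (1 / t))\<^sup>2) < ereal v"
    using V_cond v by (intro Limsup_lessD) (auto intro: le_less_trans)
  then have "\<forall>\<^sub>F n in sequentially. Vfun Pm (b (T r n)) * (h (1 / T r n))\<^sup>2 < v"
    using eventually_compose_filterlim[OF _ T_tendsto[OF r]] by simp
  with b1 have var: "\<forall>\<^sub>F n in sequentially.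
      T r n * (\<integral>y. indicator {y. norm y \<le> \<delta> * b (T r n)} y * (y \<bullet> z)\<^sup>2 \<partial>Pm) / (b (T r n))\<^sup>2 \<le> v / ln (ln (1 / T r n))"
  proof eventually_elim
    case (elim n)
    let ?t = "T r n"
    have t: "0 < ?t" "?t \<le> t0" using T[OF r, of n] t1 by auto
    have l: "0 < ln (ln (1 / ?t))" by (rule iterated_log_pos[OF t])
    have hp: "0 < h (1 / ?t)" by (rule h_pos[OF t])
    have "\<delta> * b ?t \<le> 1 * b ?t" using \<delta> b_pos[OF t] by (intro mult_right_mono) auto
    then have "(\<integral>y. indicator {y. norm y \<le> \<delta> * b ?t} y * (y \<bullet> z)\<^sup>2 \<partial>Pm) \<le> Vfun Pm (b ?t)"
      using elim by (intro truncated_variance_le_Vfun[OF z]) auto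
    then have "?t * (\<integral>y. indicator {y. norm y \<le> \<delta> * b ?t} y * (y \<bullet> z)\<^sup>2 \<partial>Pm) / (b ?t)\<^sup>2 \<le> ?t * Vfun Pm (b ?t) / (b ?t)\<^sup>2"
      using t by (intro divide_right_mono mult_left_mono) auto
    also have "\<dots> = Vfun Pm (b ?t) * (h (1 / ?t))\<^sup>2 / ln (ln (1 / ?t))"
    proof -
      have "(b ?t)\<^sup>2 = ?t * ln (ln (1 / ?t)) / (h (1 / ?t))\<^sup>2"
        using t l by (simp add: b_def[OF t] power_divide)
      then show ?thesis using t by simp
    qed
    also have "\<dots> \<le> v / ln (ln (1 / ?t))" using elim(2) l by (intro divide_right_mono) auto
    finally show ?case .
  qed
  obtain p where p: "p \<longlonglongrightarrow> 0"
    "summable (\<lambda>n. exp (- (\<kappa>'\<^sup>2 / (2 * v) * ln (ln (1 / T r n))))) \<longrightarrow> summable p"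
    "\<forall>\<^sub>F n in sequentially. \<forall>s. 0 \<le> s \<and> s \<le> T r n \<longrightarrow> prob {\<omega>\<in>space M. \<kappa> * b (T r n) < X s \<omega> \<bullet> z} \<le> p n"
    by (rule projection_tail_probabilities[OF levy z \<delta>(1,2) refl \<kappa> v0 iterated_log_T(1)[OF r] var])
  show ?thesis
  proof (rule that[OF p(1) _ p(3)], rule impI)
    assume "2 * v < \<kappa>'\<^sup>2"
    then have "1 < \<kappa>'\<^sup>2 / (2 * v)" using v0 by simp
    then show "summable p" by (intro p(2)[THEN mp] iterated_log_T(2)[OF r])
  qed
qed

lemma directional_bound:
  assumes r: "0 < r" "r < 1" and z: "norm z \<le> 1" and \<kappa>: "lam < \<kappa>"
  shows "AE \<omega> in M. \<forall>\<^sub>F n in sequentially. \<forall>s. 0 \<le> s \<and> s \<le> T r n \<longrightarrow> X s \<omega> \<bullet> z \<le> \<kappa> * b (T r n)"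
proof -
  \<comment> \<open>The room between \<open>lam\<close> and \<open>\<kappa>\<close> is shared out:
    \<open>y\<close> from \<open>\<kappa>1\<close> to \<open>\<kappa>\<close> for the maximal
    inequality, the step from \<open>\<kappa>2\<close> to \<open>\<kappa>1\<close> for the drift,
    and the step from \<open>lam\<close> to \<open>\<kappa>2\<close> for summability. Below,
    \<open>v\<close> is the midpoint of the halved squares of \<open>lam\<close> and
    \<open>\<kappa>2\<close>.\<close>
  define \<kappa>1 \<kappa>2 where "\<kappa>1 = (lam + \<kappa>) / 2" and "\<kappa>2 = (lam + \<kappa>1) / 2"
  define y where "y = \<kappa> - \<kappa>1"
  define v where "v = (lam\<^sup>2 + \<kappa>2\<^sup>2) / 4"
  have k: "lam < \<kappa>2" "\<kappa>2 < \<kappa>1" "0 < y" using \<kappa> by (auto simp: \<kappa>1_def \<kappa>2_def y_def)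
  have k0: "0 < \<kappa>2" using k lam_nonneg by simp
  have "lam\<^sup>2 < \<kappa>2\<^sup>2" using k lam_nonneg by (intro power_strict_mono) auto
  then have v: "lam\<^sup>2 / 2 < v" "2 * v < \<kappa>2\<^sup>2" by (auto simp: v_def)
  obtain p where p: "p \<longlonglongrightarrow> 0" "2 * v < \<kappa>2\<^sup>2 \<longrightarrow> summable p"
    "\<forall>\<^sub>F n in sequentially. \<forall>s. 0 \<le> s \<and> s \<le> T r n \<longrightarrow> prob {\<omega>\<in>space M. \<kappa>1 * b (T r n) < X s \<omega> \<bullet> z} \<le> p n"
    by (rule tail_probabilities[OF r z k0 k(2) v(1)])
  have z': "norm (- z) \<le> 1" using z by simp
  \<comment> \<open>The level \<open>y\<close> may lie far below \<open>lam\<close>, so only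
    \<open>p'\<close> tending to 0 is used; this suffices for the constant 1/2 in the maximal
    inequality.\<close>
  obtain p' where p': "p' \<longlonglongrightarrow> 0"
    "\<forall>\<^sub>F n in sequentially. \<forall>s. 0 \<le> s \<and> s \<le> T r n \<longrightarrow> prob {\<omega>\<in>space M. y * b (T r n) < X s \<omega> \<bullet> (- z)} \<le> p' n"
    by (rule tail_probabilities[OF r z' _ _ v(1), of "y / 2" y]) (use k in auto)
  have "\<forall>\<^sub>F n in sequentially. p' n < 1 / 2" using p'(1) by (rule order_tendstoD) simp
  with p(3) p'(2) have "\<forall>\<^sub>F n in sequentially.
      prob {\<omega>\<in>space M. \<kappa>1 * b (T r n) < X (T r n) \<omega> \<bullet> z} \<le> p n \<and>
      (\<forall>s. 0 \<le> s \<and> s \<le> T r n \<longrightarrow> prob {\<omega>\<in>space M. y * b (T r n) < X s \<omega> \<bullet> (- z)} \<le> 1 / 2)"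
  proof eventually_elim
    case (elim n)
    then show ?case using T(1)[OF r, of n] by (auto intro: order_trans[OF _ less_imp_le[OF elim(3)]])
  qed
  then obtain N where N: "\<And>n. n \<ge> N \<Longrightarrow> prob {\<omega>\<in>space M. \<kappa>1 * b (T r n) < X (T r n) \<omega> \<bullet> z} \<le> p n"
    "\<And>n s. n \<ge> N \<Longrightarrow> 0 \<le> s \<Longrightarrow> s \<le> T r n \<Longrightarrow> prob {\<omega>\<in>space M. y * b (T r n) < X s \<omega> \<bullet> (- z)} \<le> 1 / 2"
    by (auto simp: eventually_sequentially)
  define P where "P n E \<longleftrightarrow> E \<in> events \<and> prob E \<le> 2 * p n \<and>
    (\<forall>\<omega> s. \<omega> \<in> space M \<and> (\<forall>s\<ge>0. continuous (at_right s) (\<lambda>s. X s \<omega>)) \<and>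
      0 \<le> s \<and> s \<le> T r n \<and> \<kappa> * b (T r n) < X s \<omega> \<bullet> z \<longrightarrow> \<omega> \<in> E)" for n E
  have "\<exists>E. P n E" if n: "n \<ge> N" for n
  proof -
    obtain E where E: "E \<in> sets M" "prob E \<le> 2 * prob {\<omega>\<in>space M. \<kappa>1 * b (T r n) < X (T r n) \<omega> \<bullet> z}"
      "\<And>\<omega> s. \<omega> \<in> space M \<Longrightarrow> (\<And>s. 0 \<le> s \<Longrightarrow> continuous (at_right s) (\<lambda>s. X s \<omega>)) \<Longrightarrow>
      0 \<le> s \<Longrightarrow> s \<le> T r n \<Longrightarrow> \<kappa>1 * b (T r n) + y * b (T r n) < X s \<omega> \<bullet> z \<Longrightarrow> \<omega> \<in> E"
      by (rule levy_maximal_inequality[OF levy T(1)[OF r, of n], of "y * b (T r n)" z "\<kappa>1 * b (T r n)"])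
         (use N(2)[OF n] in blast)+
    have "\<kappa>1 * b (T r n) + y * b (T r n) = \<kappa> * b (T r n)" by (simp add: y_def algebra_simps)
    then have "P n E" unfolding P_def using E N(1)[OF n] by auto
    then show ?thesis ..
  qed
  then obtain E where E: "\<And>n. n \<ge> N \<Longrightarrow> P n (E n)" by metis
  \<comment> \<open>The events were chosen only from index \<open>N\<close> on, hence the
    shift.\<close>
  have "AE \<omega> in M. \<forall>\<^sub>F n in sequentially. \<omega> \<in> space M - E (n + N)"
  proof (rule borel_cantelli_AE1)
    show "E (n + N) \<in> events" for n using E[of "n + N"] by (simp add: P_def)
    show "emeasure M (E (n + N)) < \<infinity>" for n by (simp add: emeasure_eq_measure)
    show "summable (\<lambda>n. prob (E (n + N)))"
    proof (rule summable_comparison_test[OF exI[of _ 0]])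
      show "summable (\<lambda>n. 2 * p (n + N))"
        using summable_ignore_initial_segment[OF p(2)[THEN mp, OF v(2)], of N] by (rule summable_mult)
      show "\<forall>n\<ge>0. norm (prob (E (n + N))) \<le> 2 * p (n + N)" using E by (auto simp: P_def)
    qed
  qed
  moreover have "AE \<omega> in M. \<forall>t\<ge>0. continuous (at_right t) (\<lambda>s. X s \<omega>)"
    using levy unfolding purely_non_gaussian_levy_def by (elim conjE eventually_mono) blast
  ultimately show ?thesis
  proof eventually_elim
    case (elim \<omega>)
    note rc = elim(2)
    from elim(1) have "\<forall>\<^sub>F n in sequentially. \<forall>s. 0 \<le> s \<and> s \<le> T r (n + N) \<longrightarrow> X s \<omega> \<bullet> z \<le> \<kappa> * b (T r (n + N))"
    proof eventually_elim
      case (elim n)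
      then have w: "\<omega> \<in> space M" "\<omega> \<notin> E (n + N)" by auto
      show ?case
      proof (intro allI impI, rule ccontr)
        fix s assume s: "0 \<le> s \<and> s \<le> T r (n + N)" and "\<not> X s \<omega> \<bullet> z \<le> \<kappa> * b (T r (n + N))"
        then have "\<kappa> * b (T r (n + N)) < X s \<omega> \<bullet> z" by simp
        then have "\<omega> \<in> E (n + N)"
          using E[of "n + N", unfolded P_def, THEN conjunct2, THEN conjunct2, THEN spec, THEN spec, THEN mp, of \<omega> s] s w(1) rc
          by simp
        then show False using w(2) by simp
      qed
    qed
    then show ?case
      by (simp only: eventually_sequentially_seg[of "\<lambda>n. \<forall>s. 0 \<le> s \<and> s \<le> T r n \<longrightarrow> X s \<omega> \<bullet> z \<le> \<kappa> * b (T r n)"])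
  qed
qed

text \<open>The factor \<open>\<mu> / \<kappa>\<close> is split evenly: one \<open>\<theta>\<close>
  pays for replacing the sphere by a finite net, the other for filling the gap between consecutive
  geometric times.\<close>

lemma norm_bound:
  assumes \<mu>: "lam < \<mu>"
  shows "AE \<omega> in M. \<forall>\<^sub>F t in at_right 0. norm (X t \<omega>) \<le> \<mu> * b t"
proof -
  define \<kappa> where "\<kappa> = (lam + \<mu>) / 2"
  have \<kappa>: "lam < \<kappa>" "\<kappa> < \<mu>" unfolding \<kappa>_def using \<mu> by simp_all
  have \<kappa>0: "0 < \<kappa>" using \<kappa>(1) lam_nonneg by linarith
  note \<kappa> = \<kappa> \<kappa>0
  define \<theta> where "\<theta> = sqrt (\<mu> / \<kappa>)"
  have "1 < \<mu> / \<kappa>" using \<kappa> by simp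
  then have \<theta>: "1 < \<theta>" and \<theta>2: "\<theta> * \<theta> = \<mu> / \<kappa>" using \<kappa> by (simp_all add: \<theta>_def)
  define r where "r = 1 / \<theta>"
  have r: "0 < r" "r < 1" using \<theta> by (auto simp: r_def)
  \<comment> \<open>The ratio of consecutive norming values tends to \<open>sqrt r\<close>, so it
    eventually exceeds \<open>r = 1 / \<theta>\<close>; a gap thus costs at most the factor
    \<open>\<theta>\<close>.\<close>
  have "r < sqrt r" using r by (simp add: real_less_rsqrt power2_eq_square)
  then have "\<forall>\<^sub>F n in sequentially. r < b (T r (Suc n)) / b (T r n)"
    using b_T_ratio[OF r] by (intro order_tendstoD(1))
  then obtain K where K: "\<And>n. n \<ge> K \<Longrightarrow> r < b (T r (Suc n)) / b (T r n)"
    by (auto simp: eventually_sequentially)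
  have K': "b (T r n) \<le> \<theta> * b (T r (Suc n))" if "n \<ge> K" for n
    using K[OF that] b_T_pos[OF r, of n] \<theta> by (simp add: r_def field_simps)
  obtain Z :: "(real ^ 'd) set" where Z: "finite Z" "\<And>z. z \<in> Z \<Longrightarrow> norm z = 1"
    "\<And>x B. 0 \<le> B \<Longrightarrow> (\<And>z. z \<in> Z \<Longrightarrow> x \<bullet> z \<le> B) \<Longrightarrow> norm x \<le> \<theta> * B"
    using finite_sphere_net[OF \<theta>] by blast
  have "AE \<omega> in M. \<forall>z\<in>Z. \<forall>\<^sub>F n in sequentially. \<forall>s. 0 \<le> s \<and> s \<le> T r n \<longrightarrow> X s \<omega> \<bullet> z \<le> \<kappa> * b (T r n)"
    using Z by (intro AE_finite_allI directional_bound[OF r _ \<kappa>(1)]) auto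
  then show ?thesis
  proof eventually_elim
    case (elim \<omega>)
    then have "\<forall>\<^sub>F n in sequentially. \<forall>z\<in>Z. \<forall>s. 0 \<le> s \<and> s \<le> T r n \<longrightarrow> X s \<omega> \<bullet> z \<le> \<kappa> * b (T r n)"
      using Z(1) by (intro eventually_ball_finite)
    then obtain N where N: "\<And>n z s. n \<ge> N \<Longrightarrow> z \<in> Z \<Longrightarrow> 0 \<le> s \<Longrightarrow> s \<le> T r n \<Longrightarrow> X s \<omega> \<bullet> z \<le> \<kappa> * b (T r n)"
      by (auto simp: eventually_sequentially)
    define n0 where "n0 = max N K"
    have "norm (X t \<omega>) \<le> \<mu> * b t" if t: "0 < t" "t < T r n0" for t
    proof -
      have "(\<lambda>n. T r n) \<longlonglongrightarrow> 0" using T_tendsto[OF r] by (simp add: filterlim_at)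
      then have "\<forall>\<^sub>F n in sequentially. T r n < t" using t(1) by (rule order_tendstoD)
      then have ex: "\<exists>n. T r n < t" by (auto simp: eventually_sequentially)
      \<comment> \<open>The first geometric time below \<open>t\<close>; its predecessor
        \<open>n\<close> gives \<open>T r (Suc n) < t \<le> T r n\<close>. The bound over
        \<open>[0, T r n]\<close> applies at \<open>t\<close>, and
        \<open>b (T r (Suc n)) \<le> b t\<close> converts it back.\<close>
      define m where "m = (LEAST n. T r n < t)"
      have m: "T r m < t" unfolding m_def using ex by (rule LeastI_ex)
      have "T r 0 = t1" by (simp add: T_def r)
      then have "m \<noteq> 0" using m t(2) T(2)[OF r, of n0] by (intro notI) simp
      then obtain n where n: "m = Suc n" by (cases m) auto
      have "n < m" using n by simp
      then have "\<not> T r n < t" unfolding m_def by (rule not_less_Least)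
      then have tn: "t \<le> T r n" by simp
      have dec: "decseq (T r)" by (rule decseq_SucI) (rule T(4)[OF r])
      have "n0 \<le> n"
      proof (rule ccontr)
        assume "\<not> n0 \<le> n"
        then have "T r n0 \<le> T r (Suc n)" by (intro decseqD[OF dec]) simp
        then show False using m t(2) n by simp
      qed
      then have nN: "n \<ge> N" "n \<ge> K" by (auto simp: n0_def)
      have "norm (X t \<omega>) \<le> \<theta> * (\<kappa> * b (T r n))"
        by (rule Z(3)) (use \<kappa> b_T_pos[OF r, of n] N[OF nN(1)] t tn in auto)
      also have "\<dots> \<le> \<theta> * (\<kappa> * (\<theta> * b (T r (Suc n))))"
        using K'[OF nN(2)] \<kappa> \<theta> by (intro mult_left_mono) auto
      also have "\<dots> = (\<theta> * \<theta>) * \<kappa> * b (T r (Suc n))" by simp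
      also have "\<dots> = \<mu> * b (T r (Suc n))" unfolding \<theta>2 using \<kappa> by simp
      also have "\<dots> \<le> \<mu> * b t"
        using m n tn T(1)[OF r, of "Suc n"] T(2)[OF r, of n] \<kappa> by (intro mult_left_mono b_mono) auto
      finally show ?thesis .
    qed
    then show ?case using T(1)[OF r, of n0] by (auto simp: eventually_at_right_field)
  qed
qed

text \<open>The exceptional null set depends on the level, so the levels run through the countable
  sequence \<open>lam + 1 / (j + 1)\<close> before letting \<open>j\<close> grow.\<close>

lemma limsup_bound:
  "AE \<omega> in M. Limsup (at_right 0)
     (\<lambda>t. ereal (h (1 / t) * norm (X t \<omega>) / sqrt (t * ln (ln (1 / t))))) \<le> ereal lam"
proof -
  have "AE \<omega> in M. \<forall>j::nat. \<forall>\<^sub>F t in at_right 0. norm (X t \<omega>) \<le> (lam + 1 / real (Suc j)) * b t"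
    by (subst AE_all_countable) (auto intro: norm_bound)
  then show ?thesis
  proof eventually_elim
    case (elim \<omega>)
    have "Limsup (at_right 0) (\<lambda>t. ereal (h (1 / t) * norm (X t \<omega>) / sqrt (t * ln (ln (1 / t)))))
        \<le> ereal (lam + 1 / real (Suc j))" for j
    proof (rule Limsup_bounded)
      have "\<forall>\<^sub>F t in at_right 0. t < t0" using t0 by (simp add: eventually_at_right_field) blast
      with elim[THEN spec, of j] eventually_at_right_less[of 0]
      show "\<forall>\<^sub>F t in at_right 0. ereal (h (1 / t) * norm (X t \<omega>) / sqrt (t * ln (ln (1 / t)))) \<le> ereal (lam + 1 / real (Suc j))"
      proof eventually_elim
        case (elim t)
        then have t: "0 < t" "t \<le> t0" by auto
        have s: "0 < sqrt (t * ln (ln (1 / t)))" using iterated_log_pos[OF t] t by simp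
        have "h (1 / t) * norm (X t \<omega>) \<le> h (1 / t) * ((lam + 1 / real (Suc j)) * b t)"
          using elim h_pos[OF t] by (intro mult_left_mono) auto
        also have "\<dots> = (lam + 1 / real (Suc j)) * sqrt (t * ln (ln (1 / t)))"
          using h_pos[OF t] by (simp add: b_def[OF t])
        finally show ?case using s by (simp add: pos_divide_le_eq del: of_nat_Suc)
      qed
    qed
    moreover have "(\<lambda>j. ereal (lam + 1 / real (Suc j))) \<longlonglongrightarrow> ereal (lam + 0)"
      using LIMSEQ_inverse_real_of_nat by (intro tendsto_intros) (simp add: inverse_eq_divide)
    ultimately show ?case
      by (intro LIMSEQ_le_const[where X="\<lambda>j. ereal (lam + 1 / real (Suc j))"]) auto
  qed
qed

end

theorem theorem2p1:
  fixes M :: "'a measure" and X :: "real \<Rightarrow> 'a \<Rightarrow> real ^ 'd"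
    and \<gamma> :: "real ^ 'd" and Pm :: "(real ^ 'd) measure"
    and h :: "real \<Rightarrow> real" and b :: "real \<Rightarrow> real" and t0 :: real and lam :: real
  assumes levy: "purely_non_gaussian_levy M X \<gamma> Pm"
    and hH1: "H1 h"
    and t0: "0 < t0" "t0 < exp (-1)"
    and b_def: "\<And>t. 0 < t \<Longrightarrow> t \<le> t0 \<Longrightarrow> b t = sqrt (t * ln (ln (1 / t))) / h (1 / t)"
    and b_pos: "\<And>t. 0 < t \<Longrightarrow> t \<le> t0 \<Longrightarrow> b t > 0"
    and int_fin: "(\<integral>\<^sup>+ t\<in>{0<..t0}. Pibar Pm (b t) \<partial>lborel) < \<infinity>"
    and lam_nonneg: "lam \<ge> 0"
    and V_cond: "Limsup (at_right 0) (\<lambda>t. ereal (Vfun Pm (b t) * (h (1 / t))\<^sup>2)) \<le> ereal (lam\<^sup>2 / 2)"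
  shows "AE \<omega> in M. Limsup (at_right 0)
           (\<lambda>t. ereal (h (1 / t) * norm (X t \<omega>) / sqrt (t * ln (ln (1 / t))))) \<le> ereal lam"
proof -
  interpret small_time_lil M X \<gamma> Pm h b t0 lam
    using assms by unfold_locales
  show ?thesis by (rule limsup_bound)
qed

end
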